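(* For the general Geronimus transformation $\check{\vec w}$ of $\vec w=(w_1,w_2)$ by the polynomial $\tilde P(x)=p(x^2)P(x)$ of degree $\tilde N=2M+N$, let $$\mathbf W_l=\big(W_1^{(l)}(r_1^2),\dots,W_1^{(l)}(r_M^2),\,W_2^{(l)}(r_1^2),\dots,W_2^{(l)}(r_M^2),\,W_2^{(l)}(x_1^2),\dots,W_2^{(l)}(x_N^2)\big),$$ $$\boldsymbol\kappa_a(y)=\big(\kappa_{a,1}(r_1^2,y),\dots,\kappa_{a,1}(r_M^2,y),\,\kappa_{a,2}(r_1^2,y),\dots,\kappa_{a,2}(r_M^2,y),\,\kappa_{a,2}(x_1^2,y),\dots,\kappa_{a,2}(x_N^2,y)\big),$$ and let $\tau_n$ be the determinant of the $\tilde N\times\tilde N$ matrix with rows $\mathbf W_{n-\tilde N},\dots,\mathbf W_{n-1}$. Assume $\tau_n\neq0$. Then, for $n\ge\tilde N$ and $a\in\{1,2\}$, $$\check A_a^{(n)}(y)=\frac{1}{\tau_{n+1}}\begin{vmatrix}\mathbf W_{n-\tilde N+1}\\ \vdots\\ \mathbf W_{n-1}\\ \boldsymbol\kappa_a(y)\end{vmatrix},\qquad \check B^{(n)}(x)=\frac1{\tau_n}\begin{vmatrix}\mathbf W_{n-\tilde N}&B^{(n-\tilde N)}(x)\\ \vdots&\vdots\\ \mathbf W_{n-1}&B^{(n-1)}(x)\\ \mathbf W_n&B^{(n)}(x)\end{vmatrix}.$$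
   Context: Let $\Delta\subset\mathbb R$ be an interval and $w_1,w_2$ weight functions on $\Delta$ with all moments finite with respect to $\mathrm dx$. All vectors and matrices are semi-infinite, indexed by $0,1,2,\dots$. Put $X(x)=(1,x,x^2,\dots)^\top$, $X_1(x)=(1,0,x,0,x^2,0,\dots)^\top$, $X_2(x)=(0,1,0,x,0,x^2,\dots)^\top$. For a pair of weights $\vec u=(u_1,u_2)$, $g_{\vec u}=\int_\Delta X\big(X_1u_1+X_2u_2\big)^\top\mathrm dx$. Perturbing polynomial: $P(x)=(x-x_1)\cdots(x-x_N)\in\mathbb R[x]$ is monic and non-symmetric (if $x_0\neq0$ is a root, then $-x_0$ is not), $p(x)=(x-r_1^2)\cdots(x-r_M^2)\in\mathbb R[x]$, $\tilde P(x)=p(x^2)P(x)$, $\tilde N=2M+N$. Write $P(x)=P_{\mathrm e}(x^2)+xP_{\mathrm o}(x^2)$; $\tilde P_{\mathrm e}=pP_{\mathrm e}$, $\tilde P_{\mathrm o}=pP_{\mathrm o}$; $\pi(x)=P_{\mathrm e}(x)^2-xP_{\mathrm o}(x)^2$, whose zeros are $x_1^2,\dots,x_N^2$. The zeros $Z=\{r_1^2,\dots,r_M^2,x_1^2,\dots,x_N^2\}$ of $p\pi$ are assumed pairwise distinct. Geronimus perturbation: $\check{\vec w}=(\check w_1,\check w_2)$ satisfies $\check{\vec w}\begin{bmatrix}\tilde P_{\mathrm e}(x)&x\tilde P_{\mathrm o}(x)\\ \tilde P_{\mathrm o}(x)&\tilde P_{\mathrm e}(x)\end{bmatrix}=\vec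 w$, which gives $$\check{\vec w}=\frac1{\pi(x)p(x)}\vec w\begin{bmatrix}P_{\mathrm e}(x)&-xP_{\mathrm o}(x)\\ -P_{\mathrm o}(x)&P_{\mathrm e}(x)\end{bmatrix}+\vec c(x)\sum_{\zeta\in Z}\delta(x-\zeta)$$ for some vector function $\vec c=(c_1,c_2)$, $\delta$ being Dirac's delta. Integrals $\int_\Delta$ involving $\check w_a$ include the contributions of these masses (a mass at $\zeta$ in $\check w_a$ contributes $c_a(\zeta)f(\zeta)$ to $\int f\check w_a$). It is assumed that $g_{\vec w}=S^{-1}H\tilde S^{-\top}$ and $g_{\check{\vec w}}=\check S^{-1}\check H\check{\tilde S}^{-\top}$ with lower unitriangular $S,\tilde S,\check S,\check{\tilde S}$ and diagonal $H,\check H$ with nonzero entries. $B=SX$, $A_a=H^{-1}\tilde SX_a$, $\check B=\check SX$, $\check A_a=\check H^{-1}\check{\tilde S}X_a$, $a\in\{1,2\}$, with entries indexed by superscripts. Second kind functions: $C_a(z)=\int_\Delta\frac{B(x)}{z-x}w_a(x)\,\mathrm dx$. Put $$W_1^{(l)}(x)=P_{\mathrm e}(x)C_1^{(l)}(x)-P_{\mathrm o}(x)C_2^{(l)}(x)-c_1(x)(\pi p)'(x)B^{(l)}(x),$$ $$W_2^{(l)}(x)=-xP_{\mathrm o}(x)C_1^{(l)}(x)+P_{\mathrm e}(x)C_2^{(l)}(x)-c_2(x)(\pi p)'(x)B^{(l)}(x).$$ For a polynomial $R$ and $a,b\in\{1,2\}$, $\mathscr V_{a,b}^{R}(x,y)=\int_\Delta\sum_{l=0}^{n-1}\check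 B^{(l)}(t)\check A_a^{(l)}(y)\,\check w_b(t)\,\frac{R(x)-R(t)}{x-t}\,\mathrm dt$ (superscript $x\tilde P_{\mathrm o}$ means $R(x)=x\tilde P_{\mathrm o}(x)$); $$\begin{bmatrix}\mathscr P_{1,1}&\mathscr P_{1,2}\\ \mathscr P_{2,1}&\mathscr P_{2,2}\end{bmatrix}(x,y)=\begin{bmatrix}\mathscr V_{1,1}^{\tilde P_{\mathrm e}}+\mathscr V_{1,2}^{\tilde P_{\mathrm o}}&\mathscr V_{1,1}^{x\tilde P_{\mathrm o}}+\mathscr V_{1,2}^{\tilde P_{\mathrm e}}\\ \mathscr V_{2,1}^{\tilde P_{\mathrm e}}+\mathscr V_{2,2}^{\tilde P_{\mathrm o}}&\mathscr V_{2,1}^{x\tilde P_{\mathrm o}}+\mathscr V_{2,2}^{\tilde P_{\mathrm e}}\end{bmatrix}(x,y)\begin{bmatrix}P_{\mathrm e}(x)&-xP_{\mathrm o}(x)\\ -P_{\mathrm o}(x)&P_{\mathrm e}(x)\end{bmatrix},$$ and, for $b\in\{1,2\}$ (with the given $n$), $$\kappa_{1,b}(x,y)=\sum_{l=0}^{n-1}\big(\tilde P_{\mathrm e}(y)A_1^{(l)}(y)+y\tilde P_{\mathrm o}(y)A_2^{(l)}(y)\big)W_b^{(l)}(x)+\mathscr P_{1,b}(x,y),$$ $$\kappa_{2,b}(x,y)=\sum_{l=0}^{n-1}\big(\tilde P_{\mathrm o}(y)A_1^{(l)}(y)+\tilde P_{\mathrm e}(y)A_2^{(l)}(y)\big)W_b^{(l)}(x)+\mathscr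 P_{2,b}(x,y).$$
   Formalization: The formula for Ǎ_a^{(n)}(y) is proved with factor −1/τ_{n+1} in place of the printed 1/τ_{n+1}, which has the wrong sign under the given definitions; the formula for B̌^{(n)} is as printed. *)

theory Defs
  imports
    "HOL-Analysis.Analysis"
    "HOL-Computational_Algebra.Polynomial"
    "HOL-Library.Groups_Big_Fun"
    "Jordan_Normal_Form.Determinant"
begin

abbreviation cpoly :: "real poly \<Rightarrow> complex \<Rightarrow> complex"
  where "cpoly q z \<equiv> poly (map_poly complex_of_real q) z"


text \<open>Semi-infinite vectors and matrices are functions on natural numbers. The products below
  are only meaningful for finitely supported summands, which holds for triangular and
  diagonal factors.\<close>

type_synonym ivec = "nat \<Rightarrow> complex"
type_synonym imat = "nat \<Rightarrow> nat \<Rightarrow> complex"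

definition imat_mult :: "imat \<Rightarrow> imat \<Rightarrow> imat"
  where "imat_mult A B = (\<lambda>i j. Sum_any (\<lambda>k. A i k * B k j))"

definition imat_vec :: "imat \<Rightarrow> ivec \<Rightarrow> ivec"
  where "imat_vec A v = (\<lambda>i. Sum_any (\<lambda>k. A i k * v k))"

definition imat_one :: imat
  where "imat_one = (\<lambda>i j. if i = j then 1 else 0)"

definition imat_diag :: "ivec \<Rightarrow> imat"
  where "imat_diag H = (\<lambda>i j. if i = j then H i else 0)"

definition imat_transpose :: "imat \<Rightarrow> imat"
  where "imat_transpose A = (\<lambda>i j. A j i)"

definition lower_unitriangular :: "imat \<Rightarrow> bool"
  where "lower_unitriangular S \<longleftrightarrow> (\<forall>i. S i i = 1) \<and> (\<forall>i j. i < j \<longrightarrow> S i j = 0)"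

text \<open>The inverse is taken in the group of lower unitriangular matrices, where it exists and is
  unique.\<close>

definition lower_inv :: "imat \<Rightarrow> imat"
  where "lower_inv S = (THE L. lower_unitriangular L \<and>
           imat_mult S L = imat_one \<and> imat_mult L S = imat_one)"

definition LU_factorization :: "imat \<Rightarrow> imat \<Rightarrow> ivec \<Rightarrow> imat \<Rightarrow> bool"
  where "LU_factorization g S H St \<longleftrightarrow>
    lower_unitriangular S \<and> lower_unitriangular St \<and> (\<forall>n. H n \<noteq> 0) \<and>
    g = imat_mult (imat_mult (lower_inv S) (imat_diag H)) (imat_transpose (lower_inv St))"


text \<open>A weight consists of a density on the real line and of point masses, which may sit at
  arbitrary complex points (the zeros of a real polynomial need not be real).\<close>

record weight =
  dens :: "real \<Rightarrow> complex"
  mass :: "complex \<Rightarrow> complex"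

definition fun_weight :: "(real \<Rightarrow> real) \<Rightarrow> weight"
  where "fun_weight v = \<lparr>dens = (\<lambda>t. complex_of_real (v t)), mass = (\<lambda>z. 0)\<rparr>"

definition wint :: "real set \<Rightarrow> weight \<Rightarrow> (complex \<Rightarrow> complex) \<Rightarrow> complex"
  where "wint \<Delta> u f =
    (LINT t:\<Delta>|lebesgue. f (complex_of_real t) * dens u t) +
    (\<Sum>\<zeta> | mass u \<zeta> \<noteq> 0. mass u \<zeta> * f \<zeta>)"

definition weight_plus :: "weight \<Rightarrow> weight \<Rightarrow> weight"
  where "weight_plus u v = \<lparr>dens = (\<lambda>t. dens u t + dens v t), mass = (\<lambda>z. mass u z + mass v z)\<rparr>"

definition weight_times :: "weight \<Rightarrow> real poly \<Rightarrow> weight"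
  where "weight_times u q =
    \<lparr>dens = (\<lambda>t. dens u t * cpoly q (complex_of_real t)), mass = (\<lambda>z. mass u z * cpoly q z)\<rparr>"

definition weight_eq :: "real set \<Rightarrow> weight \<Rightarrow> weight \<Rightarrow> bool"
  where "weight_eq \<Delta> u v \<longleftrightarrow> (AE t in lebesgue. t \<in> \<Delta> \<longrightarrow> dens u t = dens v t) \<and> mass u = mass v"


text \<open>Pairs such as $(w_1,w_2)$ or $(X_1,X_2)$ are functions of an index in \<open>{1, 2}\<close>.\<close>

definition Xvec :: "complex \<Rightarrow> ivec"
  where "Xvec z = (\<lambda>j. z ^ j)"

definition Xcomp :: "nat \<Rightarrow> complex \<Rightarrow> ivec"
  where "Xcomp a z = (\<lambda>j. if j mod 2 = a - 1 then z ^ (j div 2) else 0)"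

definition moment_matrix :: "real set \<Rightarrow> (nat \<Rightarrow> weight) \<Rightarrow> imat"
  where "moment_matrix \<Delta> u = (\<lambda>i j. \<Sum>a\<in>{1,2}. wint \<Delta> (u a) (\<lambda>z. Xvec z i * Xcomp a z j))"

definition Bpol :: "imat \<Rightarrow> nat \<Rightarrow> complex \<Rightarrow> complex"
  where "Bpol S l z = imat_vec S (Xvec z) l"

definition Apol :: "imat \<Rightarrow> ivec \<Rightarrow> nat \<Rightarrow> nat \<Rightarrow> complex \<Rightarrow> complex"
  where "Apol St H a l z = inverse (H l) * imat_vec St (Xcomp a z) l"

definition Cfun :: "real set \<Rightarrow> (nat \<Rightarrow> weight) \<Rightarrow> imat \<Rightarrow> nat \<Rightarrow> nat \<Rightarrow> complex \<Rightarrow> complex"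
  where "Cfun \<Delta> u S a l z = wint \<Delta> (u a) (\<lambda>t. Bpol S l t / (z - t))"


definition pi_poly :: "real poly \<Rightarrow> real poly \<Rightarrow> real poly"
  where "pi_poly Pe Po = Pe\<^sup>2 - [:0, 1:] * Po\<^sup>2"

text \<open>Column \<open>b\<close> of $(v_1, v_2)$ times the adjugate matrix with rows
  $(P_{\mathrm e}(z), -zP_{\mathrm o}(z))$ and $(-P_{\mathrm o}(z), P_{\mathrm e}(z))$.\<close>

definition times_adj ::
  "real poly \<Rightarrow> real poly \<Rightarrow> complex \<Rightarrow> (nat \<Rightarrow> complex) \<Rightarrow> nat \<Rightarrow> complex"
  where "times_adj Pe Po z v b =
    (if b = 1 then v 1 * cpoly Pe z - v 2 * cpoly Po z
     else - (v 1 * z * cpoly Po z) + v 2 * cpoly Pe z)"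

definition geronimus_weight ::
  "(nat \<Rightarrow> real \<Rightarrow> real) \<Rightarrow> real poly \<Rightarrow> real poly \<Rightarrow> real poly \<Rightarrow> complex set \<Rightarrow>
   (nat \<Rightarrow> complex \<Rightarrow> complex) \<Rightarrow> nat \<Rightarrow> weight"
  where "geronimus_weight w Pe Po p Z c b =
    \<lparr>dens = (\<lambda>t. times_adj Pe Po (complex_of_real t) (\<lambda>a. complex_of_real (w a t)) b
                  / cpoly (pi_poly Pe Po * p) (complex_of_real t)),
     mass = (\<lambda>z. if z \<in> Z then c b z else 0)\<rparr>"

definition Wfun ::
  "real set \<Rightarrow> (nat \<Rightarrow> real \<Rightarrow> real) \<Rightarrow> real poly \<Rightarrow> real poly \<Rightarrow> real poly \<Rightarrow>
   (nat \<Rightarrow> complex \<Rightarrow> complex) \<Rightarrow> imat \<Rightarrow> nat \<Rightarrow> nat \<Rightarrow> complex \<Rightarrow> complex"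
  where "Wfun \<Delta> w Pe Po p c S b l z =
    times_adj Pe Po z (\<lambda>a. Cfun \<Delta> (\<lambda>a. fun_weight (w a)) S a l z) b
    - c b z * cpoly (pderiv (pi_poly Pe Po * p)) z * Bpol S l z"

text \<open>The quotient $(R(x)-R(t))/(x-t)$ is a polynomial in $x$ and $t$; its diagonal values are
  needed, since a point mass may sit at $t = x$.\<close>

definition diff_quot :: "real poly \<Rightarrow> complex \<Rightarrow> complex \<Rightarrow> complex"
  where "diff_quot R x t =
    (if x = t then cpoly (pderiv R) x else (cpoly R x - cpoly R t) / (x - t))"

definition Vker ::
  "real set \<Rightarrow> (nat \<Rightarrow> weight) \<Rightarrow> imat \<Rightarrow> ivec \<Rightarrow> imat \<Rightarrow> nat \<Rightarrow> nat \<Rightarrow> nat \<Rightarrow> real poly \<Rightarrow>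
   complex \<Rightarrow> complex \<Rightarrow> complex"
  where "Vker \<Delta> wc Sc Hc Stc n a b R x y =
    wint \<Delta> (wc b) (\<lambda>t. (\<Sum>l<n. Bpol Sc l t * Apol Stc Hc a l y) * diff_quot R x t)"

definition Pker ::
  "real set \<Rightarrow> (nat \<Rightarrow> weight) \<Rightarrow> real poly \<Rightarrow> real poly \<Rightarrow> real poly \<Rightarrow>
   imat \<Rightarrow> ivec \<Rightarrow> imat \<Rightarrow> nat \<Rightarrow> nat \<Rightarrow> nat \<Rightarrow> complex \<Rightarrow> complex \<Rightarrow> complex"
  where "Pker \<Delta> wc Pe Po p Sc Hc Stc n a b x y =
    (let V = Vker \<Delta> wc Sc Hc Stc n a; Pte = p * Pe; Pto = p * Po
     in times_adj Pe Po x
          (\<lambda>d. if d = 1 then V 1 Pte x y + V 2 Pto x y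
               else V 1 ([:0, 1:] * Pto) x y + V 2 Pte x y) b)"

definition kappa ::
  "real set \<Rightarrow> (nat \<Rightarrow> real \<Rightarrow> real) \<Rightarrow> (nat \<Rightarrow> weight) \<Rightarrow> real poly \<Rightarrow> real poly \<Rightarrow> real poly \<Rightarrow>
   (nat \<Rightarrow> complex \<Rightarrow> complex) \<Rightarrow> imat \<Rightarrow> ivec \<Rightarrow> imat \<Rightarrow> imat \<Rightarrow> ivec \<Rightarrow> imat \<Rightarrow>
   nat \<Rightarrow> nat \<Rightarrow> nat \<Rightarrow> complex \<Rightarrow> complex \<Rightarrow> complex"
  where "kappa \<Delta> w wc Pe Po p c S H St Sc Hc Stc n a b x y =
    (let A = (\<lambda>d l. Apol St H d l y); Pte = cpoly (p * Pe) y; Pto = cpoly (p * Po) y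
     in (\<Sum>l<n. (if a = 1 then Pte * A 1 l + y * Pto * A 2 l else Pto * A 1 l + Pte * A 2 l)
                * Wfun \<Delta> w Pe Po p c S b l x)
        + Pker \<Delta> wc Pe Po p Sc Hc Stc n a b x y)"


text \<open>Entry \<open>j < 2 * M + N\<close> of the row $(F_1(r_1^2),\dots,F_1(r_M^2),F_2(r_1^2),\dots,F_2(r_M^2),
  F_2(x_1^2),\dots,F_2(x_N^2))$, where the zeros $r_j$ and $x_j$ are numbered from 0.\<close>

definition node_row ::
  "nat \<Rightarrow> (nat \<Rightarrow> complex) \<Rightarrow> (nat \<Rightarrow> complex) \<Rightarrow> (nat \<Rightarrow> complex \<Rightarrow> complex) \<Rightarrow> nat \<Rightarrow> complex"
  where "node_row M r xs F j =
    (if j < M then F 1 ((r j)\<^sup>2)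
     else if j < 2 * M then F 2 ((r (j - M))\<^sup>2)
     else F 2 ((xs (j - 2 * M))\<^sup>2))"

text \<open>Determinant of an \<open>n \<times> n\<close> matrix with entries \<open>f i j\<close>, \<open>i, j < n\<close>. The qualified names
  select the matrices of variable dimension.\<close>

abbreviation det_of :: "nat \<Rightarrow> (nat \<Rightarrow> nat \<Rightarrow> complex) \<Rightarrow> complex"
  where "det_of n f \<equiv> Determinant.det (Matrix.mat n n (\<lambda>(i, j). f i j))"

definition tau :: "nat \<Rightarrow> (nat \<Rightarrow> nat \<Rightarrow> complex) \<Rightarrow> nat \<Rightarrow> complex"
  where "tau Nt Wrow n = det_of Nt (\<lambda>i j. Wrow (n - Nt + i) j)"

end

theory Submission
  imports Defs
begin

text \<open>
  Let \<open>\<Omega>\<close> be the lower unitriangular matrix expressing the perturbed polynomials through the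
  original ones. Multiplication of the pair of weights by the perturbing matrix is a shift of the
  moment matrix by \<open>p(\<Lambda>\<^sup>2) P(\<Lambda>)\<close>, so \<open>\<Omega>\<close> has only \<open>2 M + N\<close> nonzero subdiagonals, the last of
  which does not vanish, and its transpose maps the perturbed functions \<open>A\<close> to the original ones
  times the perturbing matrix.

  For a polynomial \<open>f\<close>, the combination \<open>W\<close> built from \<open>f\<close> in place of \<open>B\<close> equals, at a node
  \<open>\<zeta>\<close>, minus the integral of \<open>f\<close> against the perturbed weights times the difference quotient of the
  perturbing matrix, times its adjugate: the perturbing matrix times its adjugate vanishes at
  \<open>\<zeta>\<close>, and the masses lie in the left kernel of the perturbing matrix, so only its derivative
  at \<open>\<zeta>\<close> survives. Orthogonality then gives \<open>\<Omega> W = 0\<close> in the rows from \<open>2 M + N\<close> on, and the same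
  identity shows that the row \<open>\<kappa>\<close> is a combination of the rows \<open>W\<^sub>l\<close>, \<open>n - (2 M + N) \<le> l < n\<close>, whose
  first coefficient is \<open>\<Omega>\<close> at \<open>(n, n - (2 M + N))\<close> times the perturbed \<open>A\<close>. The determinant formulas
  are row operations. Passing from \<open>\<tau>\<^sub>n\<close> to \<open>\<tau>\<^sub>n\<^sub>+\<^sub>1\<close> replaces the first row by minus the same entry
  of \<open>\<Omega>\<close> times it, moved to the end: this is where the minus sign comes from.
\<close>

section \<open>Lower unitriangular matrices\<close>

text \<open>Row \<open>i\<close> of \<open>A\<close> is supported in \<open>k \<le> i\<close>, which
  turns \<open>Sum_any\<close> into a finite sum. The free bound \<open>m\<close> lets different
  rows share one summation range.\<close>

lemma imat_mult_lower:
  assumes "lower_unitriangular A" "i \<le> m"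
  shows "imat_mult A B i j = (\<Sum>k\<le>m. A i k * B k j)"
  unfolding imat_mult_def
  by (rule Sum_any.expand_superset)
    (use assms in \<open>auto simp: lower_unitriangular_def intro!: leI dest: le_less_trans\<close>)

lemma imat_vec_lower:
  assumes "lower_unitriangular A" "i \<le> m"
  shows "imat_vec A v i = (\<Sum>k\<le>m. A i k * v k)"
  unfolding imat_vec_def
  by (rule Sum_any.expand_superset)
    (use assms in \<open>auto simp: lower_unitriangular_def intro!: leI dest: le_less_trans\<close>)

lemma lower_unitriangular_mult:
  assumes A: "lower_unitriangular A" and B: "lower_unitriangular B"
  shows "lower_unitriangular (imat_mult A B)"
proof -
  have "imat_mult A B i i = 1" for i
  proof -
    have "imat_mult A B i i = (\<Sum>k\<le>i. if k = i then 1 else 0)"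
      unfolding imat_mult_lower[OF A order_refl]
      by (rule sum.cong) (use A B in \<open>auto simp: lower_unitriangular_def\<close>)
    then show ?thesis by simp
  qed
  moreover have "imat_mult A B i j = 0" if "i < j" for i j
    unfolding imat_mult_lower[OF A order_refl]
    by (rule sum.neutral) (use that B in \<open>auto simp: lower_unitriangular_def\<close>)
  ultimately show ?thesis unfolding lower_unitriangular_def by auto
qed

text \<open>Triangularity of the two left factors makes every sum finite, so the sums can be
  exchanged. \<open>C\<close> is arbitrary because it will also be a full matrix or a vector written
  as a matrix.\<close>

lemma imat_mult_assoc:
  assumes A: "lower_unitriangular A" and B: "lower_unitriangular B"
  shows "imat_mult (imat_mult A B) C = imat_mult A (imat_mult B C)"
proof (intro ext)
  fix i j
  have "imat_mult (imat_mult A B) C i j = (\<Sum>k\<le>i. (\<Sum>l\<le>i. A i l * B l k) * C k j)"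
    by (simp add: imat_mult_lower[OF lower_unitriangular_mult[OF A B] order_refl]
        imat_mult_lower[OF A order_refl])
  also have "\<dots> = (\<Sum>l\<le>i. A i l * (\<Sum>k\<le>i. B l k * C k j))"
    by (simp add: sum_distrib_left sum_distrib_right mult.assoc) (rule sum.swap)
  also have "\<dots> = imat_mult A (imat_mult B C) i j"
    unfolding imat_mult_lower[OF A order_refl]
    by (rule sum.cong) (auto simp: imat_mult_lower[OF B])
  finally show "imat_mult (imat_mult A B) C i j = imat_mult A (imat_mult B C) i j" .
qed

lemma imat_mult_one_right:
  assumes "lower_unitriangular A"
  shows "imat_mult A imat_one = A"
proof (intro ext)
  fix i j
  have "imat_mult A imat_one i j = (\<Sum>k\<le>i. if k = j then A i k else 0)"
    unfolding imat_mult_lower[OF assms order_refl] imat_one_def by (rule sum.cong) auto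
  then show "imat_mult A imat_one i j = A i j"
    using assms by (auto simp: lower_unitriangular_def)
qed

lemma lower_unitriangular_one: "lower_unitriangular imat_one"
  by (auto simp: lower_unitriangular_def imat_one_def)

lemma imat_mult_one_left: "imat_mult imat_one A = A"
proof (intro ext)
  fix i j
  have "imat_mult imat_one A i j = (\<Sum>k\<le>i. if k = i then A k j else 0)"
    unfolding imat_mult_lower[OF lower_unitriangular_one order_refl]
    by (rule sum.cong) (auto simp: imat_one_def)
  then show "imat_mult imat_one A i j = A i j" by simp
qed

section \<open>Inverses of lower unitriangular matrices by forward substitution\<close>

context
  notes sum.cong[fundef_cong]
begin

text \<open>Solves \<open>S L = 1\<close> row by row, using that the diagonal of \<open>S\<close> is
  1. The congruence rule for sums tells the termination proof that \<open>k < i\<close>.\<close>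

fun forward_subst :: "imat \<Rightarrow> imat"
  where "forward_subst S i j = imat_one i j - (\<Sum>k<i. S i k * forward_subst S k j)"

end

declare forward_subst.simps [simp del]

lemma forward_subst:
  assumes S: "lower_unitriangular S"
  shows "lower_unitriangular (forward_subst S)" "imat_mult S (forward_subst S) = imat_one"
proof -
  have zero: "forward_subst S i j = 0" if "i < j" for i j
    using that
  proof (induction i rule: less_induct)
    case (less i)
    then show ?case
      by (subst forward_subst.simps) (auto simp: imat_one_def intro!: sum.neutral)
  qed
  then show "lower_unitriangular (forward_subst S)"
    unfolding lower_unitriangular_def
    by (auto simp: forward_subst.simps[of S i i for i] imat_one_def intro!: sum.neutral)
  show "imat_mult S (forward_subst S) = imat_one"
  proof (intro ext)
    fix i j
    have "imat_mult S (forward_subst S) i j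
        = (\<Sum>k<i. S i k * forward_subst S k j) + S i i * forward_subst S i j"
      by (simp add: imat_mult_lower[OF S order_refl] lessThan_Suc_atMost[symmetric])
    also have "\<dots> = imat_one i j"
      using S by (subst (2) forward_subst.simps) (simp add: lower_unitriangular_def)
    finally show "imat_mult S (forward_subst S) i j = imat_one i j" .
  qed
qed

text \<open>Forward substitution gives a right inverse \<open>L\<close>. A right inverse
  \<open>T\<close> of \<open>L\<close> satisfies \<open>T = (S L) T = S (L T) = S\<close>, so
  \<open>L\<close> is two-sided; associativity also gives the uniqueness that the definite
  description requires.\<close>

lemma lower_inv:
  assumes S: "lower_unitriangular S"
  shows "lower_unitriangular (lower_inv S)" "imat_mult S (lower_inv S) = imat_one"
    "imat_mult (lower_inv S) S = imat_one"
proof -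
  define L where "L = forward_subst S"
  have L: "lower_unitriangular L" "imat_mult S L = imat_one"
    unfolding L_def using forward_subst[OF S] by auto
  define T where "T = forward_subst L"
  have T: "lower_unitriangular T" "imat_mult L T = imat_one"
    unfolding T_def using forward_subst[OF L(1)] by auto
  have "T = imat_mult (imat_mult S L) T" by (simp add: L imat_mult_one_left)
  also have "\<dots> = S" by (subst imat_mult_assoc) (simp_all add: S L T imat_mult_one_right)
  finally have LS: "imat_mult L S = imat_one" using T(2) by simp
  have "\<exists>!K. lower_unitriangular K \<and> imat_mult S K = imat_one \<and> imat_mult K S = imat_one"
  proof (rule ex1I[of _ L])
    fix K assume K: "lower_unitriangular K \<and> imat_mult S K = imat_one \<and> imat_mult K S = imat_one"
    have "K = imat_mult (imat_mult K S) L"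
      using K by (subst imat_mult_assoc) (simp_all add: S L imat_mult_one_right)
    then show "K = L" using K by (simp add: imat_mult_one_left)
  qed (use L LS in auto)
  from theI'[OF this, folded lower_inv_def]
  show "lower_unitriangular (lower_inv S)" "imat_mult S (lower_inv S) = imat_one"
    "imat_mult (lower_inv S) S = imat_one" by auto
qed

lemma LU_entry:
  assumes "LU_factorization g S H St"
  shows "g i j = (\<Sum>k\<le>i. lower_inv S i k * (H k * lower_inv St j k))"
proof -
  have S: "lower_unitriangular S" and g: "g = imat_mult (imat_mult (lower_inv S) (imat_diag H))
      (imat_transpose (lower_inv St))"
    using assms by (auto simp: LU_factorization_def)
  note L = lower_inv(1)[OF S]
  have d: "imat_mult (lower_inv S) (imat_diag H) i k = lower_inv S i k * H k" for k
  proof -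
    have "imat_mult (lower_inv S) (imat_diag H) i k
        = (\<Sum>l\<le>i. if l = k then lower_inv S i l * H l else 0)"
      unfolding imat_mult_lower[OF L order_refl] imat_diag_def by (rule sum.cong) auto
    then show ?thesis using L by (auto simp: lower_unitriangular_def)
  qed
  show ?thesis
    unfolding g imat_mult_def[of "imat_mult _ _"] d imat_transpose_def mult.assoc
    by (rule Sum_any.expand_superset)
      (use L in \<open>auto simp: lower_unitriangular_def not_le[symmetric]\<close>)
qed

text \<open>Cancelling the left factor of \<open>g\<close> leaves \<open>H\<close> times an upper
  triangular matrix. The entries with \<open>j < n\<close> therefore vanish: this is the
  orthogonality of the row polynomials.\<close>

lemma LU_mult_left:
  assumes LU: "LU_factorization g S H St"
  shows "(\<Sum>i\<le>n. S n i * g i j) = H n * lower_inv St j n"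
proof -
  have S: "lower_unitriangular S" using LU by (simp add: LU_factorization_def)
  define D where "D = (\<lambda>k j. H k * lower_inv St j k)"
  have "g = imat_mult (lower_inv S) D"
    by (intro ext) (simp add: LU_entry[OF LU] imat_mult_lower[OF lower_inv(1)[OF S] order_refl] D_def)
  then have "imat_mult S g = D"
    by (simp add: imat_mult_assoc[symmetric] S lower_inv imat_mult_one_left)
  then show ?thesis
    using imat_mult_lower[OF S order_refl, of g n j] by (simp add: D_def)
qed

section \<open>Determinants with a replaced row\<close>

lemma det_of_mult:
  "det_of m (\<lambda>i j. \<Sum>l<m. T i l * V l j) = det_of m T * det_of m V"
proof -
  have "Matrix.mat m m (\<lambda>(i, j). \<Sum>l<m. T i l * V l j)
      = Matrix.mat m m (\<lambda>(i, j). T i j) * Matrix.mat m m (\<lambda>(i, j). V i j)"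
    by (rule eq_matI) (auto simp: scalar_prod_def atLeast0LessThan)
  then show ?thesis by (simp add: det_mult[of _ m])
qed

lemma det_of_cong:
  assumes "\<And>i j. i < m \<Longrightarrow> j < m \<Longrightarrow> f i j = g i j"
  shows "det_of m f = det_of m g"
  by (rule arg_cong[of _ _ Determinant.det]) (use assms in \<open>auto intro!: eq_matI\<close>)

lemma mat_delete_mat:
  assumes "i \<le> m" "j \<le> m"
  shows "mat_delete (Matrix.mat (Suc m) (Suc m) (\<lambda>(i, j). f i j)) i j
    = Matrix.mat m m (\<lambda>(k, l). f (if k < i then k else Suc k) (if l < j then l else Suc l))"
  by (rule eq_matI) (use assms in \<open>auto simp: mat_delete_def\<close>)

lemma det_of_last_row:
  assumes "\<And>j. j < m \<Longrightarrow> f m j = 0"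
  shows "det_of (Suc m) f = f m m * det_of m f"
proof -
  let ?A = "Matrix.mat (Suc m) (Suc m) (\<lambda>(i, j). f i j)"
  have "Determinant.det ?A = (\<Sum>j<Suc m. ?A $$ (m, j) * cofactor ?A m j)"
    by (rule laplace_expansion_row) auto
  also have "\<dots> = f m m * cofactor ?A m m" using assms by simp
  also have "cofactor ?A m m = det_of m f"
  proof -
    have "mat_delete ?A m m = Matrix.mat m m (\<lambda>(i, j). f i j)"
      unfolding mat_delete_mat[OF order_refl order_refl] by (rule eq_matI) auto
    then show ?thesis by (simp add: cofactor_def)
  qed
  finally show ?thesis .
qed

text \<open>The matrix is \<open>T V\<close>, where \<open>T\<close> moves each row up by one and
  puts the coefficients \<alpha> into the last row. Expanding the determinant of \<open>T\<close>
  along its first column leaves only \<open>\<alpha> 0\<close>.\<close>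

lemma det_of_replace_last_row:
  assumes "0 < m"
  shows "det_of m (\<lambda>i j. if i < m - 1 then V (Suc i) j else (\<Sum>l<m. \<alpha> l * V l j))
    = (- 1) ^ (m - 1) * \<alpha> 0 * det_of m V"
proof -
  obtain k where m: "m = Suc k" using assms by (cases m) auto
  define T where "T = (\<lambda>i l. if i < k then (if l = Suc i then 1 else 0) else \<alpha> l)"
  let ?A = "Matrix.mat m m (\<lambda>(i, j). T i j)"
  have "det_of m (\<lambda>i j. if i < m - 1 then V (Suc i) j else (\<Sum>l<m. \<alpha> l * V l j))
      = det_of m (\<lambda>i j. \<Sum>l<m. T i l * V l j)"
  proof (rule det_of_cong)
    fix i j assume "i < m"
    show "(if i < m - 1 then V (Suc i) j else (\<Sum>l<m. \<alpha> l * V l j)) = (\<Sum>l<m. T i l * V l j)"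
    proof (cases "i < k")
      case True
      then have "(\<Sum>l<m. T i l * V l j) = (\<Sum>l<m. if l = Suc i then V l j else 0)"
        by (intro sum.cong) (auto simp: T_def)
      then show ?thesis using True by (simp add: m)
    qed (simp add: T_def m)
  qed
  moreover have "det_of m T = (- 1) ^ (m - 1) * \<alpha> 0"
  proof -
    have "Determinant.det ?A = (\<Sum>i<m. ?A $$ (i, 0) * cofactor ?A i 0)"
      by (rule laplace_expansion_column) (use m in auto)
    also have "\<dots> = \<alpha> 0 * cofactor ?A k 0"
      by (simp add: m T_def)
    also have "cofactor ?A k 0 = (- 1) ^ k"
    proof -
      have "mat_delete ?A k 0 = 1\<^sub>m k"
        unfolding m mat_delete_mat[OF order_refl le0] by (rule eq_matI) (auto simp: T_def)
      then show ?thesis by (simp add: cofactor_def)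
    qed
    finally show ?thesis by (simp add: m)
  qed
  ultimately show ?thesis by (simp add: det_of_mult)
qed

text \<open>Replacing the last row by the combination with coefficients \<alpha> is multiplication
  by a triangular matrix of determinant 1, because \<open>\<alpha> m = 1\<close>. It clears the row
  except for the border entry.\<close>

lemma det_of_bordered:
  assumes \<alpha>: "\<alpha> m = 1" and zero: "\<And>j. j < m \<Longrightarrow> (\<Sum>l\<le>m. \<alpha> l * V l j) = 0"
  shows "det_of (Suc m) (\<lambda>i j. if j < m then V i j else b i) = det_of m V * (\<Sum>l\<le>m. \<alpha> l * b l)"
proof -
  define T where "T = (\<lambda>i l. if i < m then (if l = i then 1 else 0) else \<alpha> l)"
  define U where "U = (\<lambda>i j. if j < m then V i j else b i)"
  define R where "R = (\<lambda>i j. if i < m then U i j else (\<Sum>l\<le>m. \<alpha> l * U l j))"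
  have "det_of (Suc m) R = det_of (Suc m) (\<lambda>i j. \<Sum>l<Suc m. T i l * U l j)"
  proof (rule det_of_cong)
    fix i j assume "i < Suc m"
    show "R i j = (\<Sum>l<Suc m. T i l * U l j)"
    proof (cases "i < m")
      case True
      then have "(\<Sum>l<Suc m. T i l * U l j) = (\<Sum>l<Suc m. if l = i then U l j else 0)"
        by (intro sum.cong) (auto simp: T_def)
      then show ?thesis using True by (simp add: R_def)
    qed (simp add: T_def R_def lessThan_Suc_atMost)
  qed
  also have "\<dots> = det_of (Suc m) T * det_of (Suc m) U" by (rule det_of_mult)
  also have "det_of (Suc m) T = 1"
    by (subst det_lower_triangular[of "Suc m"]) (auto simp: T_def prod_list_diag_prod \<alpha>)
  finally have "det_of (Suc m) U = det_of (Suc m) R" by simp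
  also have "\<dots> = R m m * det_of m R"
    by (rule det_of_last_row) (simp add: R_def U_def zero)
  also have "det_of m R = det_of m V"
    by (rule det_of_cong) (simp add: R_def U_def)
  finally show ?thesis by (simp add: U_def R_def)
qed

section \<open>Complexified real polynomials\<close>

lemma map_poly_of_real_pCons:
  "map_poly complex_of_real (pCons a q) = pCons (complex_of_real a) (map_poly complex_of_real q)"
  by (simp add: map_poly_pCons)

lemma cpoly_add: "cpoly (q + s) z = cpoly q z + cpoly s z"
proof -
  have "map_poly complex_of_real (q + s) = map_poly complex_of_real q + map_poly complex_of_real s"
    by (rule poly_eqI) (simp add: coeff_map_poly)
  then show ?thesis by simp
qed

lemma cpoly_pCons: "cpoly (pCons a q) z = complex_of_real a + z * cpoly q z"
  by (simp add: map_poly_of_real_pCons)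

lemma cpoly_smult: "cpoly (Polynomial.smult a q) z = complex_of_real a * cpoly q z"
  by (induction q) (simp_all add: cpoly_pCons algebra_simps)

lemma cpoly_diff: "cpoly (q - s) z = cpoly q z - cpoly s z"
  using cpoly_add[of q "Polynomial.smult (-1) s" z] by (simp only: cpoly_smult) simp

lemma cpoly_mult: "cpoly (q * s) z = cpoly q z * cpoly s z"
  by (induction q) (simp_all add: cpoly_pCons cpoly_add cpoly_smult algebra_simps)

lemma cpoly_power2: "cpoly (q\<^sup>2) z = (cpoly q z)\<^sup>2"
  by (simp add: power2_eq_square cpoly_mult)

lemma cpoly_pcompose: "cpoly (pcompose q s) z = cpoly q (cpoly s z)"
  by (induction q) (simp_all add: pcompose_pCons cpoly_pCons cpoly_add cpoly_mult)

lemmas cpoly_simps = cpoly_add cpoly_diff cpoly_mult cpoly_power2 cpoly_smult cpoly_pCons cpoly_pcompose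

lemma map_poly_of_real_pderiv:
  "map_poly complex_of_real (pderiv q) = pderiv (map_poly complex_of_real q)"
  by (rule poly_eqI) (simp add: coeff_map_poly coeff_pderiv)

lemma cpoly_pderiv_mult:
  "cpoly (pderiv (q * s)) z = cpoly q z * cpoly (pderiv s) z + cpoly s z * cpoly (pderiv q) z"
  by (simp add: pderiv_mult cpoly_simps)

lemma cpoly_pderiv_X_mult:
  "cpoly (pderiv ([:0, 1:] * q)) z = cpoly q z + z * cpoly (pderiv q) z"
proof -
  have X: "pderiv [:0, 1:] = [:1::real:]" by (simp add: pderiv_pCons)
  show ?thesis unfolding cpoly_pderiv_mult X by (simp add: cpoly_pCons)
qed

lemma cpoly_pderiv_pi_poly:
  "cpoly (pderiv (pi_poly Pe Po)) z = 2 * cpoly Pe z * cpoly (pderiv Pe) z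
    - (cpoly Po z)\<^sup>2 - 2 * z * cpoly Po z * cpoly (pderiv Po) z"
  unfolding pi_poly_def pderiv_diff power2_eq_square cpoly_diff
  unfolding cpoly_pderiv_X_mult unfolding cpoly_pderiv_mult
  by (simp add: cpoly_simps algebra_simps power2_eq_square)

lemma cpoly_pi_poly: "cpoly (pi_poly Pe Po) z = (cpoly Pe z)\<^sup>2 - z * (cpoly Po z)\<^sup>2"
  by (simp add: pi_poly_def cpoly_simps)

abbreviation dquot_poly :: "real poly \<Rightarrow> complex \<Rightarrow> complex poly"
  where "dquot_poly R x \<equiv> synthetic_div (map_poly complex_of_real R) x"

text \<open>Synthetic division gives \<open>R(t) = (t - x) s(t) + R(x)\<close>; differentiating at
  \<open>t = x\<close> supplies the diagonal value.\<close>

lemma diff_quot_eq_poly: "diff_quot R x t = poly (dquot_poly R x) t"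
proof -
  let ?q = "map_poly complex_of_real R" and ?s = "dquot_poly R x"
  have q: "?q = [:-x, 1:] * ?s + [:poly ?q x:]" by (rule synthetic_div_correct'[symmetric])
  have "pderiv ?q = ?s + [:-x, 1:] * pderiv ?s"
    by (subst q) (simp del: mult_pCons_left add: pderiv_add pderiv_mult pderiv_pCons)
  then have "cpoly (pderiv R) x = poly ?s x"
    by (simp add: map_poly_of_real_pderiv)
  moreover have "poly ?q t = (t - x) * poly ?s t + poly ?q x"
    by (subst (1) q) (simp add: algebra_simps)
  then have "poly ?q x - poly ?q t = (x - t) * poly ?s t" by (simp add: algebra_simps)
  ultimately show ?thesis by (auto simp: diff_quot_def)
qed

lemma coeff_dquot_poly_eq_0:
  assumes "degree R \<le> i"
  shows "coeff (dquot_poly R x) i = 0"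
proof (cases "degree (map_poly complex_of_real R) = 0")
  case True
  then show ?thesis using synthetic_div_eq_0_iff by (metis coeff_0)
next
  case False
  then show ?thesis
    by (intro coeff_eq_0) (use assms degree_map_poly[of complex_of_real R] in
        \<open>simp add: degree_synthetic_div\<close>)
qed

lemma coeff_compose_square_even:
  "coeff (pcompose q [:0, 0, 1:]) (2 * i) = (coeff q i :: 'a :: comm_ring_1)"
proof (induction q arbitrary: i)
  case (pCons a q)
  then show ?case by (cases i) (auto simp: pcompose_pCons coeff_pCons split: nat.splits)
qed simp

lemma coeff_compose_square_odd:
  "coeff (pcompose q [:0, 0, 1:]) (Suc (2 * i)) = (0 :: 'a :: comm_ring_1)"
proof (induction q arbitrary: i)
  case (pCons a q)
  then show ?case by (cases i) (auto simp: pcompose_pCons coeff_pCons split: nat.splits)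
qed simp

section \<open>Integrability of the perturbed weights\<close>

lemma set_integral_sum:
  fixes f :: "'i \<Rightarrow> 'a \<Rightarrow> 'b :: {banach, second_countable_topology}"
  assumes "\<And>i. i \<in> I \<Longrightarrow> set_integrable L A (f i)"
  shows "set_integrable L A (\<lambda>t. \<Sum>i\<in>I. f i t)"
    and "(LINT t:A|L. \<Sum>i\<in>I. f i t) = (\<Sum>i\<in>I. LINT t:A|L. f i t)"
  using assms by (auto simp: set_integrable_def set_lebesgue_integral_def scaleR_sum_right)

text \<open>The exceptional points may be complex; only finitely many of them are real, and these
  form a null set.\<close>

lemma set_integral_cong_off_finite:
  fixes f g :: "real \<Rightarrow> complex"
  assumes Y: "finite Y" and eq: "\<And>t. complex_of_real t \<notin> Y \<Longrightarrow> f t = g t"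
  shows "set_integrable lebesgue A f \<longleftrightarrow> set_integrable lebesgue A g"
    and "(LINT t:A|lebesgue. f t) = (LINT t:A|lebesgue. g t)"
proof -
  let ?X = "complex_of_real -` Y"
  have "finite ?X" using Y by (intro finite_vimageI) (auto simp: inj_def)
  then have X: "countable ?X" by (rule countable_finite)
  show "set_integrable lebesgue A f \<longleftrightarrow> set_integrable lebesgue A g"
    unfolding set_integrable_def
    by (rule integrable_discrete_difference[OF X]) (auto simp: eq)
  show "(LINT t:A|lebesgue. f t) = (LINT t:A|lebesgue. g t)"
    unfolding set_lebesgue_integral_def
    by (rule integral_discrete_difference[OF X]) (auto simp: eq)
qed

lemma set_integrable_poly_mult:
  fixes v :: "real \<Rightarrow> complex"
  assumes "\<And>k. set_integrable L A (\<lambda>t. complex_of_real t ^ k * v t)"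
  shows "set_integrable L A (\<lambda>t. poly F (complex_of_real t) * v t)"
proof -
  have "set_integrable L A (\<lambda>t. \<Sum>k\<le>degree F. coeff F k * (complex_of_real t ^ k * v t))"
    by (intro set_integral_sum set_integrable_mult_right assms)
  then show ?thesis by (simp add: poly_altdef sum_distrib_right mult.assoc)
qed

text \<open>Partial fractions, by induction on the number of poles. Two distinct poles are separated
  by writing the quotient as a divided difference of quotients with one pole less. For a single
  pole, dividing \<open>F\<close> by \<open>t - \<zeta>\<close> leaves moments and one Cauchy
  integral.\<close>

lemma set_integrable_poly_over_prod:
  fixes v :: "real \<Rightarrow> complex"
  assumes mom: "\<And>k. set_integrable lebesgue A (\<lambda>t. complex_of_real t ^ k * v t)"
    and cauchy: "\<And>\<zeta>. \<zeta> \<in> Y \<Longrightarrow> set_integrable lebesgue A (\<lambda>t. v t / (\<zeta> - complex_of_real t))"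
    and "finite Y"
  shows "set_integrable lebesgue A
    (\<lambda>t. poly F (complex_of_real t) * v t / (\<Prod>\<zeta>\<in>Y. complex_of_real t - \<zeta>))"
  using \<open>finite Y\<close> cauchy
proof (induction "card Y" arbitrary: Y rule: less_induct)
  case less
  show ?case
  proof (cases "\<exists>\<zeta> \<zeta>'. \<zeta> \<in> Y \<and> \<zeta>' \<in> Y \<and> \<zeta> \<noteq> \<zeta>'")
    case True
    then obtain \<zeta> \<zeta>' where z: "\<zeta> \<in> Y" "\<zeta>' \<in> Y" "\<zeta> \<noteq> \<zeta>'" by blast
    define G where "G = (\<lambda>X t. poly F (complex_of_real t) * v t / (\<Prod>\<zeta>\<in>X. complex_of_real t - \<zeta>))"
    have 1: "set_integrable lebesgue A (G (Y - {x}))" if "x \<in> Y" for x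
      unfolding G_def by (rule less.hyps[OF card_Diff1_less]) (use that less.prems in auto)
    have int: "set_integrable lebesgue A (\<lambda>t. (G (Y - {\<zeta>'}) t - G (Y - {\<zeta>}) t) / (\<zeta> - \<zeta>'))"
      by (intro set_integrable_divide set_integral_diff 1 z)
    have eq: "(G (Y - {\<zeta>'}) t - G (Y - {\<zeta>}) t) / (\<zeta> - \<zeta>') = G Y t"
      if t: "complex_of_real t \<notin> Y" for t
    proof -
      define Q where "Q = (\<Prod>\<eta>\<in>Y - {\<zeta>, \<zeta>'}. complex_of_real t - \<eta>)"
      have a: "(\<Prod>\<eta>\<in>Y - {\<zeta>'}. complex_of_real t - \<eta>) = (complex_of_real t - \<zeta>) * Q"
        using less.prems(1) z unfolding Q_def
        by (subst prod.remove[of _ \<zeta>]) (auto intro!: prod.cong)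
      have b: "(\<Prod>\<eta>\<in>Y - {\<zeta>}. complex_of_real t - \<eta>) = (complex_of_real t - \<zeta>') * Q"
        using less.prems(1) z unfolding Q_def
        by (subst prod.remove[of _ \<zeta>']) (auto intro!: prod.cong)
      have c: "(\<Prod>\<eta>\<in>Y. complex_of_real t - \<eta>)
          = (complex_of_real t - \<zeta>') * ((complex_of_real t - \<zeta>) * Q)"
        using less.prems(1) z by (simp add: prod.remove[of Y \<zeta>'] a)
      have "Q \<noteq> 0" using t less.prems(1) by (auto simp: Q_def)
      moreover have "complex_of_real t - \<zeta> \<noteq> 0" "complex_of_real t - \<zeta>' \<noteq> 0" "\<zeta> - \<zeta>' \<noteq> 0"
        using t z by auto
      ultimately show ?thesis unfolding G_def a b c by (simp add: divide_simps) (simp add: algebra_simps)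
    qed
    show ?thesis
      using iffD1[OF set_integral_cong_off_finite(1)[OF less.prems(1) eq] int] unfolding G_def .
  next
    case False
    then consider "Y = {}" | \<zeta> where "Y = {\<zeta>}" by blast
    then show ?thesis
    proof cases
      case 1
      then show ?thesis using set_integrable_poly_mult[OF mom] by simp
    next
      case 2
      let ?s = "synthetic_div F \<zeta>"
      have F: "poly F t = (t - \<zeta>) * poly ?s t + poly F \<zeta>" for t
        by (subst (1) synthetic_div_correct'[of \<zeta> F, symmetric]) (simp add: algebra_simps)
      have int: "set_integrable lebesgue A
          (\<lambda>t. poly ?s (complex_of_real t) * v t - poly F \<zeta> * (v t / (\<zeta> - complex_of_real t)))"
        using 2 by (intro set_integral_diff set_integrable_poly_mult[OF mom] set_integrable_mult_right
            less.prems) auto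
      have eq: "poly ?s (complex_of_real t) * v t - poly F \<zeta> * (v t / (\<zeta> - complex_of_real t))
          = poly F (complex_of_real t) * v t / (\<Prod>\<zeta>\<in>Y. complex_of_real t - \<zeta>)"
        if "complex_of_real t \<notin> Y" for t
      proof -
        have "complex_of_real t - \<zeta> \<noteq> 0" "\<zeta> - complex_of_real t \<noteq> 0" using that 2 by auto
        then show ?thesis
          by (simp add: 2 F[of "complex_of_real t"] divide_simps) (simp add: algebra_simps)
      qed
      show ?thesis
        by (rule iffD1[OF set_integral_cong_off_finite(1)[OF less.prems(1) eq] int])
    qed
  qed
qed

section \<open>Linearity of multiplication by the adjugate\<close>

lemma times_adj_add:
  "times_adj Pe Po z (\<lambda>d. f d + g d) b = times_adj Pe Po z f b + times_adj Pe Po z g b"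
  by (simp add: times_adj_def algebra_simps)

lemma times_adj_mult:
  "times_adj Pe Po z (\<lambda>d. a * f d) b = a * times_adj Pe Po z f b"
  by (simp add: times_adj_def algebra_simps)

lemma times_adj_sum:
  "times_adj Pe Po z (\<lambda>d. \<Sum>i\<in>I. f i d) b = (\<Sum>i\<in>I. times_adj Pe Po z (f i) b)"
  by (simp add: times_adj_def sum_distrib_left sum_distrib_right sum_subtractf sum.distrib sum_negf)

text \<open>Coefficients independent of \<open>v\<close> allow integrals to be pulled through
  \<open>times_adj\<close>.\<close>

lemma times_adj_coeffs:
  obtains \<alpha> \<beta> where "\<And>v. times_adj Pe Po z v b = \<alpha> * v 1 + \<beta> * v 2"
proof
  show "times_adj Pe Po z v b = (if b = 1 then cpoly Pe z else - (z * cpoly Po z)) * v 1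
      + (if b = 1 then - cpoly Po z else cpoly Pe z) * v 2" for v
    by (simp add: times_adj_def)
qed

text \<open>The assumption \<open>masses\<close> is the point part of the perturbation equations at
  a node: the original weights have no masses, so the masses form a left null vector of the
  perturbing matrix.\<close>

locale geronimus =
  fixes \<Delta> :: "real set" and w :: "nat \<Rightarrow> real \<Rightarrow> real"
    and P p Pe Po :: "real poly" and N M :: nat and xs r :: "nat \<Rightarrow> complex"
    and Z :: "complex set" and c :: "nat \<Rightarrow> complex \<Rightarrow> complex"
  assumes moments: "\<And>a k. a \<in> {1,2} \<Longrightarrow> set_integrable lebesgue \<Delta> (\<lambda>t. t ^ k * w a t)"
    and P_roots: "map_poly complex_of_real P = (\<Prod>j<N. [:- xs j, 1:])"
    and p_roots: "map_poly complex_of_real p = (\<Prod>j<M. [:- ((r j)\<^sup>2), 1:])"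
    and parts: "P = pcompose Pe [:0, 0, 1:] + [:0, 1:] * pcompose Po [:0, 0, 1:]"
    and distinct_zeros:
      "distinct (map (\<lambda>j. (r j)\<^sup>2) [0..<M] @ map (\<lambda>j. (xs j)\<^sup>2) [0..<N])"
    and Z: "Z = (\<lambda>j. (r j)\<^sup>2) ` {..<M} \<union> (\<lambda>j. (xs j)\<^sup>2) ` {..<N}"
    and cauchy_integrals: "\<And>a \<zeta>. a \<in> {1,2} \<Longrightarrow> \<zeta> \<in> Z \<Longrightarrow>
      set_integrable lebesgue \<Delta> (\<lambda>t. complex_of_real (w a t) / (\<zeta> - complex_of_real t))"
    and masses: "\<And>\<zeta>. \<zeta> \<in> Z \<Longrightarrow> c 1 \<zeta> * cpoly (p * Pe) \<zeta> + c 2 \<zeta> * cpoly (p * Po) \<zeta> = 0"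
      "\<And>\<zeta>. \<zeta> \<in> Z \<Longrightarrow> c 1 \<zeta> * cpoly ([:0, 1:] * (p * Po)) \<zeta> + c 2 \<zeta> * cpoly (p * Pe) \<zeta> = 0"
begin

abbreviation "wc \<equiv> geronimus_weight w Pe Po p Z c"

lemma finite_Z: "finite Z"
  by (simp add: Z)

text \<open>With \<open>u\<close> a square root of \<open>z\<close>, \<pi>(z) is
  \<open>P(u) P(-u)\<close>, and each root of \<open>P\<close> contributes
  \<open>-(z - x_j^2)\<close>; hence the sign. Distinctness of the zeros turns the indexed products
  into one product over the set \<open>Z\<close>.\<close>

lemma cpoly_pi_p: "cpoly (pi_poly Pe Po * p) z = (- 1) ^ N * (\<Prod>\<zeta>\<in>Z. z - \<zeta>)"
proof -
  let ?s = "csqrt z"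
  have s: "?s * ?s = z" by (metis power2_csqrt power2_eq_square)
  have P: "cpoly P u = (\<Prod>j<N. u - xs j)" for u
    by (simp add: P_roots poly_prod)
  have "cpoly (pi_poly Pe Po) z = cpoly P ?s * cpoly P (- ?s)"
  proof -
    have "cpoly P u = cpoly Pe (u * u) + u * cpoly Po (u * u)" for u
      by (simp add: parts cpoly_simps)
    moreover have "(e + u * v) * (e + - u * v) = e\<^sup>2 - u * u * v\<^sup>2" for e u v :: complex
      by (simp add: algebra_simps power2_eq_square)
    ultimately show ?thesis by (simp add: cpoly_pi_poly s)
  qed
  also have "\<dots> = (\<Prod>j<N. - 1 * (z - (xs j)\<^sup>2))"
    unfolding P prod.distrib[symmetric] by (rule prod.cong) (use s in \<open>simp_all add: algebra_simps power2_eq_square\<close>)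
  also have "\<dots> = (- 1) ^ N * (\<Prod>j<N. z - (xs j)\<^sup>2)"
    by (simp only: prod.distrib) simp
  finally have "cpoly (pi_poly Pe Po) z = (- 1) ^ N * (\<Prod>j<N. z - (xs j)\<^sup>2)" .
  moreover have "cpoly p z = (\<Prod>j<M. z - (r j)\<^sup>2)"
    by (simp add: p_roots poly_prod)
  moreover have "(\<Prod>\<zeta>\<in>Z. z - \<zeta>) = (\<Prod>j<M. z - (r j)\<^sup>2) * (\<Prod>j<N. z - (xs j)\<^sup>2)"
  proof -
    have d: "inj_on (\<lambda>j. (r j)\<^sup>2) {..<M}" "inj_on (\<lambda>j. (xs j)\<^sup>2) {..<N}"
      "(\<lambda>j. (r j)\<^sup>2) ` {..<M} \<inter> (\<lambda>j. (xs j)\<^sup>2) ` {..<N} = {}"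
      using distinct_zeros by (auto simp: distinct_map atLeast0LessThan)
    then show ?thesis
      unfolding Z by (subst prod.union_disjoint) (auto simp: prod.reindex)
  qed
  ultimately show ?thesis by (simp add: cpoly_mult)
qed

lemma integrable_w:
  assumes "a \<in> {1,2}"
  shows "set_integrable lebesgue \<Delta> (\<lambda>t. complex_of_real t ^ k * complex_of_real (w a t))"
  using moments[OF assms, of k] unfolding set_integrable_def
  by (drule_tac integrable_of_real[where 'a = complex]) (simp add: scaleR_conv_of_real mult.assoc)

lemmas integrable_poly_w = set_integrable_poly_mult[OF integrable_w]

lemma integrable_cauchy_w:
  assumes "a \<in> {1,2}" "\<zeta> \<in> Z"
  shows "set_integrable lebesgue \<Delta>
    (\<lambda>t. poly F (complex_of_real t) / (\<zeta> - complex_of_real t) * complex_of_real (w a t))"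
proof -
  \<comment> \<open>The sign of \<open>F\<close> changes because the product has the factor
    \<open>t - \<zeta>\<close> while the Cauchy kernel has \<open>\<zeta> - t\<close>.\<close>
  have "set_integrable lebesgue \<Delta>
      (\<lambda>t. poly (-F) (complex_of_real t) * complex_of_real (w a t) / (\<Prod>\<zeta>\<in>{\<zeta>}. complex_of_real t - \<zeta>))"
    by (rule set_integrable_poly_over_prod) (use assms integrable_w cauchy_integrals in auto)
  then show ?thesis by (simp add: minus_divide_right)
qed

lemma dens_wc:
  "dens (wc 1) t = (complex_of_real (w 1 t) * cpoly Pe t - complex_of_real (w 2 t) * cpoly Po t)
      / cpoly (pi_poly Pe Po * p) t"
  "dens (wc 2) t = (complex_of_real (w 2 t) * cpoly Pe t - complex_of_real (w 1 t) * t * cpoly Po t)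
      / cpoly (pi_poly Pe Po * p) t"
  by (simp_all add: geronimus_weight_def times_adj_def)

text \<open>The adjugate times the perturbing matrix is \<pi> p times the identity, and off
  \<open>Z\<close> this factor cancels the denominator of the densities.\<close>

lemma dens_wc_perturbation:
  assumes "complex_of_real t \<notin> Z"
  shows "dens (wc 1) t * cpoly (p * Pe) t + dens (wc 2) t * cpoly (p * Po) t = complex_of_real (w 1 t)"
    and "dens (wc 1) t * cpoly ([:0, 1:] * (p * Po)) t + dens (wc 2) t * cpoly (p * Pe) t
      = complex_of_real (w 2 t)"
proof -
  have "cpoly (pi_poly Pe Po * p) t \<noteq> 0"
    unfolding cpoly_pi_p using assms finite_Z by auto
  then have nz: "cpoly (pi_poly Pe Po) t \<noteq> 0" "cpoly p t \<noteq> 0"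
    by (auto simp: cpoly_mult)
  have e: "(u * e - v * o') / (q * s) * (s * e) + (v * e - u * x * o') / (q * s) * (s * o') = u"
    "(u * e - v * o') / (q * s) * (x * (s * o')) + (v * e - u * x * o') / (q * s) * (s * e) = v"
    if "q = e\<^sup>2 - x * o'\<^sup>2" "q \<noteq> 0" "s \<noteq> 0" for u v e o' x q s :: complex
  proof -
    have "(u * e - v * o') / (q * s) * (s * e) + (v * e - u * x * o') / (q * s) * (s * o') = u * (e\<^sup>2 - x * o'\<^sup>2) / q"
      using that(2,3) by (simp add: divide_simps) (simp add: algebra_simps power2_eq_square)
    then show "(u * e - v * o') / (q * s) * (s * e) + (v * e - u * x * o') / (q * s) * (s * o') = u"
      using that by simp
    have "(u * e - v * o') / (q * s) * (x * (s * o')) + (v * e - u * x * o') / (q * s) * (s * e) = v * (e\<^sup>2 - x * o'\<^sup>2) / q"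
      using that(2,3) by (simp add: divide_simps) (simp add: algebra_simps power2_eq_square)
    then show "(u * e - v * o') / (q * s) * (x * (s * o')) + (v * e - u * x * o') / (q * s) * (s * e) = v"
      using that by simp
  qed
  have X: "cpoly [:0, 1:] t = t" by (simp add: cpoly_pCons)
  show "dens (wc 1) t * cpoly (p * Pe) t + dens (wc 2) t * cpoly (p * Po) t
      = complex_of_real (w 1 t)"
    "dens (wc 1) t * cpoly ([:0, 1:] * (p * Po)) t + dens (wc 2) t * cpoly (p * Pe) t
      = complex_of_real (w 2 t)"
    unfolding dens_wc cpoly_mult X by (rule e[OF cpoly_pi_poly nz])+
qed

text \<open>Each density is a combination of \<open>w 1\<close> and \<open>w 2\<close> with
  polynomial coefficients, divided by the product over the nodes, so the partial fraction argument
  applies to each term.\<close>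

lemma integrable_poly_wc:
  assumes "b \<in> {1,2}"
  shows "set_integrable lebesgue \<Delta> (\<lambda>t. poly F (complex_of_real t) * dens (wc b) t)"
proof -
  have 1: "set_integrable lebesgue \<Delta> (\<lambda>t. (- 1) ^ N * (poly F (complex_of_real t)
      * complex_of_real (w a t) / (\<Prod>\<zeta>\<in>Z. complex_of_real t - \<zeta>)))" if "a \<in> {1,2}" for F a
    by (intro set_integrable_mult_right impI set_integrable_poly_over_prod[OF integrable_w[OF that]
        cauchy_integrals[OF that] finite_Z])
  have m: "a * ((x * e - y * o') / ((- 1) ^ N * q))
      = (- 1) ^ N * (a * e * x / q) - (- 1) ^ N * (a * o' * y / q)" for a x y e o' q :: complex
    by (cases "even N") (simp_all add: divide_inverse algebra_simps)
  let ?c = "map_poly complex_of_real"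
  show ?thesis
  proof (cases "b = 1")
    case True
    have "set_integrable lebesgue \<Delta> (\<lambda>t. (- 1) ^ N * (poly (F * ?c Pe) (complex_of_real t)
      * complex_of_real (w 1 t) / (\<Prod>\<zeta>\<in>Z. complex_of_real t - \<zeta>)) -
      (- 1) ^ N * (poly (F * ?c Po) (complex_of_real t)
      * complex_of_real (w 2 t) / (\<Prod>\<zeta>\<in>Z. complex_of_real t - \<zeta>)))"
      by (rule set_integral_diff(1)[OF 1 1]) simp_all
    then show ?thesis
      unfolding True dens_wc cpoly_pi_p m poly_mult .
  next
    case False
    have "set_integrable lebesgue \<Delta> (\<lambda>t. (- 1) ^ N * (poly (F * ?c Pe) (complex_of_real t)
      * complex_of_real (w 2 t) / (\<Prod>\<zeta>\<in>Z. complex_of_real t - \<zeta>)) -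
      (- 1) ^ N * (poly (F * (?c Po * [:0, 1:])) (complex_of_real t)
      * complex_of_real (w 1 t) / (\<Prod>\<zeta>\<in>Z. complex_of_real t - \<zeta>)))"
      by (rule set_integral_diff(1)[OF 1 1]) simp_all
    moreover have "b = 2" using assms False by auto
    ultimately show ?thesis
      unfolding \<open>b = 2\<close> dens_wc cpoly_pi_p mult.assoc[of "complex_of_real (w 1 _)"] m poly_mult
      by (simp add: mult_ac)
  qed
qed


subsection \<open>Second kind functions at the nodes\<close>

definition wmom :: "nat \<Rightarrow> complex poly \<Rightarrow> complex"
  where "wmom a f = wint \<Delta> (fun_weight (w a)) (poly f)"

definition mom :: "nat \<Rightarrow> complex poly \<Rightarrow> complex"
  where "mom b f = wint \<Delta> (wc b) (poly f)"

lemma wint_fun_weight: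
  "wint \<Delta> (fun_weight v) f = (LINT t:\<Delta>|lebesgue. f (complex_of_real t) * complex_of_real (v t))"
  by (simp add: wint_def fun_weight_def)

lemma wint_wc:
  "wint \<Delta> (wc b) f = (LINT t:\<Delta>|lebesgue. f (complex_of_real t) * dens (wc b) t)
    + (\<Sum>\<zeta>\<in>Z. c b \<zeta> * f \<zeta>)"
proof -
  have "(\<Sum>\<zeta> | mass (wc b) \<zeta> \<noteq> 0. mass (wc b) \<zeta> * f \<zeta>) = (\<Sum>\<zeta>\<in>Z. c b \<zeta> * f \<zeta>)"
    by (rule sum.mono_neutral_cong_left) (auto simp: finite_Z geronimus_weight_def)
  then show ?thesis by (simp add: wint_def)
qed

lemma wmom_sum:
  assumes "a \<in> {1,2}"
  shows "wmom a (\<Sum>i\<in>I. Polynomial.smult (u i) (f i)) = (\<Sum>i\<in>I. u i * wmom a (f i))"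
proof -
  have "wmom a (\<Sum>i\<in>I. Polynomial.smult (u i) (f i))
      = (LINT t:\<Delta>|lebesgue. \<Sum>i\<in>I. u i * (poly (f i) (complex_of_real t) * complex_of_real (w a t)))"
    by (simp add: wmom_def wint_fun_weight poly_sum sum_distrib_right mult.assoc)
  also have "\<dots> = (\<Sum>i\<in>I. u i * wmom a (f i))"
    by (subst set_integral_sum) (auto simp: wmom_def wint_fun_weight intro!: integrable_poly_w assms)
  finally show ?thesis .
qed

lemma mom_sum:
  assumes "b \<in> {1,2}"
  shows "mom b (\<Sum>i\<in>I. Polynomial.smult (u i) (f i)) = (\<Sum>i\<in>I. u i * mom b (f i))"
proof -
  have "mom b (\<Sum>i\<in>I. Polynomial.smult (u i) (f i))
      = (LINT t:\<Delta>|lebesgue. \<Sum>i\<in>I. u i * (poly (f i) (complex_of_real t) * dens (wc b) t))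
        + (\<Sum>\<zeta>\<in>Z. \<Sum>i\<in>I. u i * (c b \<zeta> * poly (f i) \<zeta>))"
    by (simp add: mom_def wint_wc poly_sum sum_distrib_right sum_distrib_left mult_ac)
  also have "(LINT t:\<Delta>|lebesgue. \<Sum>i\<in>I. u i * (poly (f i) (complex_of_real t) * dens (wc b) t))
      = (\<Sum>i\<in>I. u i * (LINT t:\<Delta>|lebesgue. poly (f i) (complex_of_real t) * dens (wc b) t))"
    by (subst set_integral_sum) (auto intro!: integrable_poly_wc[OF assms])
  also have "(\<Sum>\<zeta>\<in>Z. \<Sum>i\<in>I. u i * (c b \<zeta> * poly (f i) \<zeta>))
      = (\<Sum>i\<in>I. u i * (\<Sum>\<zeta>\<in>Z. c b \<zeta> * poly (f i) \<zeta>))"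
    by (subst sum.swap) (simp add: sum_distrib_left)
  finally show ?thesis
    by (simp add: mom_def wint_wc sum.distrib distrib_left)
qed

lemma mom_mult_poly:
  assumes "b \<in> {1,2}" "\<And>i. K \<le> i \<Longrightarrow> coeff Q i = 0"
  shows "mom b (f * Q) = (\<Sum>i<K. coeff Q i * mom b (f * [:0, 1:] ^ i))"
proof -
  have "Q = (\<Sum>i<K. Polynomial.smult (coeff Q i) ([:0, 1:] ^ i))"
  proof (rule poly_eqI)
    fix k
    have "coeff (\<Sum>i<K. Polynomial.smult (coeff Q i) ([:0, 1:] ^ i)) k
        = (\<Sum>i<K. if i = k then coeff Q i else 0)"
      by (simp add: coeff_sum flip: monom_altdef)
    then show "coeff Q k = coeff (\<Sum>i<K. Polynomial.smult (coeff Q i) ([:0, 1:] ^ i)) k"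
      using assms(2)[of k] by (simp add: not_less)
  qed
  then have "f * Q = (\<Sum>i<K. Polynomial.smult (coeff Q i) (f * [:0, 1:] ^ i))"
    by (metis (no_types, lifting) mult_smult_right sum.cong sum_distrib_left)
  then show ?thesis by (simp only: mom_sum[OF assms(1)])
qed

text \<open>The densities satisfy the perturbation equations off the finite set \<open>Z\<close>,
  and the mass terms cancel by \<open>masses\<close>. Both columns of the perturbing matrix are
  instances of \<open>gen\<close>.\<close>

lemma wmom_eq_mom:
  "wmom 1 f = mom 1 (f * map_poly complex_of_real (p * Pe)) + mom 2 (f * map_poly complex_of_real (p * Po))"
  "wmom 2 f = mom 1 (f * map_poly complex_of_real ([:0, 1:] * (p * Po)))
    + mom 2 (f * map_poly complex_of_real (p * Pe))"
proof -
  have gen: "wmom a f = mom 1 (f * map_poly complex_of_real Q1) + mom 2 (f * map_poly complex_of_real Q2)"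
    if d: "\<And>t. complex_of_real t \<notin> Z \<Longrightarrow>
        dens (wc 1) t * cpoly Q1 t + dens (wc 2) t * cpoly Q2 t = complex_of_real (w a t)"
      and m: "\<And>\<zeta>. \<zeta> \<in> Z \<Longrightarrow> c 1 \<zeta> * cpoly Q1 \<zeta> + c 2 \<zeta> * cpoly Q2 \<zeta> = 0"
    for a Q1 Q2
  proof -
    let ?Q1 = "map_poly complex_of_real Q1" and ?Q2 = "map_poly complex_of_real Q2"
    have "wmom a f = (LINT t:\<Delta>|lebesgue. poly (f * ?Q1) (complex_of_real t) * dens (wc 1) t
        + poly (f * ?Q2) (complex_of_real t) * dens (wc 2) t)"
      unfolding wmom_def wint_fun_weight
      by (rule set_integral_cong_off_finite(2)[OF finite_Z])
        (simp add: d[symmetric] algebra_simps)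
    also have "\<dots> = (LINT t:\<Delta>|lebesgue. poly (f * ?Q1) (complex_of_real t) * dens (wc 1) t)
        + (LINT t:\<Delta>|lebesgue. poly (f * ?Q2) (complex_of_real t) * dens (wc 2) t)"
      by (intro set_integral_add(2) integrable_poly_wc) auto
    finally have 1: "wmom a f = \<dots>" .
    have "(\<Sum>\<zeta>\<in>Z. c 1 \<zeta> * poly (f * ?Q1) \<zeta>) + (\<Sum>\<zeta>\<in>Z. c 2 \<zeta> * poly (f * ?Q2) \<zeta>)
        = (\<Sum>\<zeta>\<in>Z. poly f \<zeta> * (c 1 \<zeta> * cpoly Q1 \<zeta> + c 2 \<zeta> * cpoly Q2 \<zeta>))"
      by (simp add: sum.distrib[symmetric] algebra_simps)
    also have "\<dots> = 0" by (intro sum.neutral ballI) (simp only: m mult_zero_right)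
    finally have "(\<Sum>\<zeta>\<in>Z. c 1 \<zeta> * poly (f * ?Q1) \<zeta>) + (\<Sum>\<zeta>\<in>Z. c 2 \<zeta> * poly (f * ?Q2) \<zeta>) = 0" .
    moreover have "x + y = x + u + (y + v)" if "u + v = 0" for x y u v :: complex
      using that by (simp add: add_eq_0_iff)
    ultimately show ?thesis unfolding 1 mom_def wint_wc by blast
  qed
  show "wmom 1 f = mom 1 (f * map_poly complex_of_real (p * Pe))
      + mom 2 (f * map_poly complex_of_real (p * Po))"
    by (rule gen) (use dens_wc_perturbation masses in auto)
  show "wmom 2 f = mom 1 (f * map_poly complex_of_real ([:0, 1:] * (p * Po)))
    + mom 2 (f * map_poly complex_of_real (p * Pe))"
    by (rule gen) (use dens_wc_perturbation masses in auto)
qed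

text \<open>The function \<^const>\<open>Wfun\<close> with a polynomial in place of \<open>B\<close>, so that it becomes linear.\<close>

definition Wlin :: "complex poly \<Rightarrow> nat \<Rightarrow> complex \<Rightarrow> complex"
  where "Wlin f b \<zeta> = times_adj Pe Po \<zeta>
      (\<lambda>a. LINT t:\<Delta>|lebesgue. poly f (complex_of_real t) / (\<zeta> - complex_of_real t) * complex_of_real (w a t)) b
    - c b \<zeta> * cpoly (pderiv (pi_poly Pe Po * p)) \<zeta> * poly f \<zeta>"

text \<open>At a node the Cauchy integrals converge, which justifies exchanging the integral with
  the sum.\<close>

lemma Wlin_sum:
  assumes "\<zeta> \<in> Z"
  shows "Wlin (\<Sum>i\<in>I. Polynomial.smult (u i) (f i)) b \<zeta> = (\<Sum>i\<in>I. u i * Wlin (f i) b \<zeta>)"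
proof -
  define J where "J = (\<lambda>f a. LINT t:\<Delta>|lebesgue.
      poly f (complex_of_real t) / (\<zeta> - complex_of_real t) * complex_of_real (w a t))"
  have J: "J (\<Sum>i\<in>I. Polynomial.smult (u i) (f i)) a = (\<Sum>i\<in>I. u i * J (f i) a)"
    if "a \<in> {1,2}" for a
  proof -
    have "J (\<Sum>i\<in>I. Polynomial.smult (u i) (f i)) a = (LINT t:\<Delta>|lebesgue. \<Sum>i\<in>I. u i *
        (poly (f i) (complex_of_real t) / (\<zeta> - complex_of_real t) * complex_of_real (w a t)))"
      by (simp add: J_def poly_sum sum_distrib_right sum_divide_distrib mult.assoc)
    also have "\<dots> = (\<Sum>i\<in>I. u i * J (f i) a)"
      unfolding J_def
      by (subst set_integral_sum(2)) (simp_all only: set_integrable_mult_right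
          integrable_cauchy_w[OF that assms] set_integral_mult_right)
    finally show ?thesis .
  qed
  have "times_adj Pe Po \<zeta> (J (\<Sum>i\<in>I. Polynomial.smult (u i) (f i))) b
      = times_adj Pe Po \<zeta> (\<lambda>a. \<Sum>i\<in>I. u i * J (f i) a) b"
    by (simp add: times_adj_def J)
  also have "\<dots> = (\<Sum>i\<in>I. u i * times_adj Pe Po \<zeta> (J (f i)) b)"
    by (simp add: times_adj_sum times_adj_mult)
  finally have T: "times_adj Pe Po \<zeta> (J (\<Sum>i\<in>I. Polynomial.smult (u i) (f i))) b = \<dots>" .
  have W: "Wlin g b \<zeta> = times_adj Pe Po \<zeta> (J g) b
      - c b \<zeta> * cpoly (pderiv (pi_poly Pe Po * p)) \<zeta> * poly g \<zeta>" for g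
    by (simp only: Wlin_def J_def)
  show ?thesis
    unfolding W T right_diff_distrib sum_subtractf
    by (simp add: poly_sum sum_distrib_left sum_distrib_right mult_ac)
qed

text \<open>The integral of \<open>f\<close> against the perturbed weights times column \<open>d\<close> of the difference quotient
  of the perturbing matrix.\<close>

definition Vrow :: "complex poly \<Rightarrow> complex \<Rightarrow> nat \<Rightarrow> complex"
  where "Vrow f \<zeta> d = (if d = 1
      then mom 1 (f * dquot_poly (p * Pe) \<zeta>) + mom 2 (f * dquot_poly (p * Po) \<zeta>)
      else mom 1 (f * dquot_poly ([:0, 1:] * (p * Po)) \<zeta>) + mom 2 (f * dquot_poly (p * Pe) \<zeta>))"

text \<open>Each row of the perturbing matrix times the adjugate is a row of \<pi> p times the
  identity, and \<pi> p vanishes at the nodes.\<close>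

lemma times_adj_matrix_eq_0:
  assumes "\<zeta> \<in> Z"
  shows "times_adj Pe Po \<zeta> (\<lambda>d. if d = 1 then cpoly (p * Pe) \<zeta> else cpoly ([:0, 1:] * (p * Po)) \<zeta>) b = 0"
    and "times_adj Pe Po \<zeta> (\<lambda>d. if d = 1 then cpoly (p * Po) \<zeta> else cpoly (p * Pe) \<zeta>) b = 0"
proof -
  have "cpoly (pi_poly Pe Po) \<zeta> * cpoly p \<zeta> = 0"
    unfolding cpoly_mult[symmetric] cpoly_pi_p using assms finite_Z by auto
  then have "((cpoly Pe \<zeta>)\<^sup>2 - \<zeta> * (cpoly Po \<zeta>)\<^sup>2) * cpoly p \<zeta> = 0" by (simp only: cpoly_pi_poly)
  then show "times_adj Pe Po \<zeta> (\<lambda>d. if d = 1 then cpoly (p * Pe) \<zeta> else cpoly ([:0, 1:] * (p * Po)) \<zeta>) b = 0"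
    "times_adj Pe Po \<zeta> (\<lambda>d. if d = 1 then cpoly (p * Po) \<zeta> else cpoly (p * Pe) \<zeta>) b = 0"
    unfolding times_adj_def cpoly_mult cpoly_pCons by (simp_all add: algebra_simps power2_eq_square)
qed

lemma dquot_poly_eq:
  assumes "t \<noteq> x"
  shows "poly (dquot_poly R x) t = (cpoly R x - cpoly R t) / (x - t)"
  using assms diff_quot_eq_poly[of R x t] by (simp add: diff_quot_def)

text \<open>Contribution of the mass at \<open>\<eta>\<close> to \<open>Vrow\<close>; it vanishes away from the diagonal because the vector
  of masses is in the left kernel of the perturbing matrix.\<close>

lemma mass_term:
  assumes z: "\<zeta> \<in> Z" "\<eta> \<in> Z" and b: "b \<in> {1,2}"
  shows "times_adj Pe Po \<zeta> (\<lambda>d. if d = 1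
      then c 1 \<eta> * poly (dquot_poly (p * Pe) \<zeta>) \<eta> + c 2 \<eta> * poly (dquot_poly (p * Po) \<zeta>) \<eta>
      else c 1 \<eta> * poly (dquot_poly ([:0, 1:] * (p * Po)) \<zeta>) \<eta> + c 2 \<eta> * poly (dquot_poly (p * Pe) \<zeta>) \<eta>) b
    = (if \<eta> = \<zeta> then c b \<zeta> * cpoly (pderiv (pi_poly Pe Po * p)) \<zeta> else 0)"
    (is "times_adj Pe Po \<zeta> ?v b = _")
proof (cases "\<eta> = \<zeta>")
  case False
  let ?k = "1 / (\<zeta> - \<eta>)"
  have "?v = (\<lambda>d. ?k * (c 1 \<eta> * (if d = 1 then cpoly (p * Pe) \<zeta> else cpoly ([:0, 1:] * (p * Po)) \<zeta>)
      + c 2 \<eta> * (if d = 1 then cpoly (p * Po) \<zeta> else cpoly (p * Pe) \<zeta>)))"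
  proof (rule ext)
    fix d
    have e: "u * ((x - y) / k) + v * ((x' - y') / k) = 1 / k * (u * x + v * x')"
      if "u * y + v * y' = 0" for u v x x' y y' k :: complex
    proof -
      have "u * ((x - y) / k) + v * ((x' - y') / k) = 1 / k * (u * x + v * x' - (u * y + v * y'))"
        by (simp add: divide_inverse algebra_simps)
      then show ?thesis using that by simp
    qed
    show "?v d = ?k * (c 1 \<eta> * (if d = 1 then cpoly (p * Pe) \<zeta> else cpoly ([:0, 1:] * (p * Po)) \<zeta>)
      + c 2 \<eta> * (if d = 1 then cpoly (p * Po) \<zeta> else cpoly (p * Pe) \<zeta>))"
      unfolding dquot_poly_eq[OF False]
      using e[OF masses(1)[OF z(2)], of "cpoly (p * Pe) \<zeta>" "\<zeta> - \<eta>" "cpoly (p * Po) \<zeta>"]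
        e[OF masses(2)[OF z(2)], of "cpoly ([:0, 1:] * (p * Po)) \<zeta>" "\<zeta> - \<eta>" "cpoly (p * Pe) \<zeta>"]
      by (cases "d = 1") (simp_all only: if_True if_False refl)
  qed
  then show ?thesis
    using False by (simp only: times_adj_mult times_adj_add times_adj_matrix_eq_0[OF z(1)]) simp
next
  case True
  have d: "poly (dquot_poly R \<zeta>) \<zeta> = cpoly (pderiv R) \<zeta>" for R
    using diff_quot_eq_poly[of R \<zeta> \<zeta>] by (simp add: diff_quot_def)
  have m: "c 1 \<zeta> * (cpoly p \<zeta> * cpoly Pe \<zeta>) + c 2 \<zeta> * (cpoly p \<zeta> * cpoly Po \<zeta>) = 0"
    "c 1 \<zeta> * (\<zeta> * (cpoly p \<zeta> * cpoly Po \<zeta>)) + c 2 \<zeta> * (cpoly p \<zeta> * cpoly Pe \<zeta>) = 0"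
    using masses[OF z(1)] by (simp_all add: cpoly_mult cpoly_pCons)
  \<comment> \<open>With \<open>K\<close> the perturbing matrix and \<open>L\<close> its adjugate
    factor, \<open>c K' L = c (K L)' - c K L'\<close>. Here \<open>K L\<close> is \<pi> p times the
    identity and \<open>c K = 0\<close>; \<open>e1\<close> and \<open>e2\<close> are the two
    columns.\<close>
  have e1: "(c1 * (p0 * e' + e * p') + c2 * (p0 * o' + v * p')) * e
      - (c1 * (p0 * v + x * (p0 * o' + v * p')) + c2 * (p0 * e' + e * p')) * v
      = c1 * ((e\<^sup>2 - x * v\<^sup>2) * p' + p0 * (2 * e * e' - v\<^sup>2 - 2 * x * v * o'))"
    if "c1 * (p0 * e) + c2 * (p0 * v) = 0" "c1 * (x * (p0 * v)) + c2 * (p0 * e) = 0"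
    for c1 c2 p0 e v x e' o' p' :: complex
  proof -
    have "c1 * ((e\<^sup>2 - x * v\<^sup>2) * p' + p0 * (2 * e * e' - v\<^sup>2 - 2 * x * v * o'))
      - ((c1 * (p0 * e' + e * p') + c2 * (p0 * o' + v * p')) * e
      - (c1 * (p0 * v + x * (p0 * o' + v * p')) + c2 * (p0 * e' + e * p')) * v)
      = e' * (c1 * (p0 * e) + c2 * (p0 * v)) - o' * (c1 * (x * (p0 * v)) + c2 * (p0 * e))"
      by (simp add: algebra_simps power2_eq_square)
    then show ?thesis unfolding that by simp
  qed
  have e2: "- ((c1 * (p0 * e' + e * p') + c2 * (p0 * o' + v * p')) * x * v)
      + (c1 * (p0 * v + x * (p0 * o' + v * p')) + c2 * (p0 * e' + e * p')) * e
      = c2 * ((e\<^sup>2 - x * v\<^sup>2) * p' + p0 * (2 * e * e' - v\<^sup>2 - 2 * x * v * o'))"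
    if "c1 * (p0 * e) + c2 * (p0 * v) = 0" "c1 * (x * (p0 * v)) + c2 * (p0 * e) = 0"
    for c1 c2 p0 e v x e' o' p' :: complex
  proof -
    have "c2 * ((e\<^sup>2 - x * v\<^sup>2) * p' + p0 * (2 * e * e' - v\<^sup>2 - 2 * x * v * o'))
      - (- ((c1 * (p0 * e' + e * p') + c2 * (p0 * o' + v * p')) * x * v)
      + (c1 * (p0 * v + x * (p0 * o' + v * p')) + c2 * (p0 * e' + e * p')) * e)
      = e' * (c1 * (x * (p0 * v)) + c2 * (p0 * e)) - (x * o' + v) * (c1 * (p0 * e) + c2 * (p0 * v))"
      by (simp add: algebra_simps power2_eq_square)
    then show ?thesis unfolding that by simp
  qed
  have "b = 1 \<or> b = 2" using b by auto
  then show ?thesis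
  proof
    assume "b = 1"
    then show ?thesis
      unfolding True d times_adj_def cpoly_pderiv_X_mult
      unfolding cpoly_pderiv_mult cpoly_pderiv_pi_poly cpoly_pi_poly cpoly_mult
      using e1[OF m] by simp
  next
    assume "b = 2"
    then show ?thesis
      unfolding True d times_adj_def cpoly_pderiv_X_mult
      unfolding cpoly_pderiv_mult cpoly_pderiv_pi_poly cpoly_pi_poly cpoly_mult
      using e2[OF m] by simp
  qed
qed

text \<open>Writing the original weights as the perturbed ones times the matrix at \<open>t\<close>,
  the Cauchy integrand plus the difference quotient leaves the matrix at \<zeta> over
  \<open>\<zeta> - t\<close>, which the adjugate at \<zeta> kills. The masses contribute only at
  \<zeta>, and exactly the correction term in \<open>Wlin\<close>.\<close>

lemma Wlin_eq_Vrow: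
  assumes z: "\<zeta> \<in> Z" and b: "b \<in> {1,2}"
  shows "Wlin f b \<zeta> = - times_adj Pe Po \<zeta> (Vrow f \<zeta>) b"
proof -
  let ?I = "\<lambda>g. LINT t:\<Delta>|lebesgue. g t"
  \<comment> \<open>\<open>D i d\<close> is the entry in row \<open>i\<close> and column
    \<open>d\<close> of the difference quotient of the perturbing matrix.\<close>
  define D where "D = (\<lambda>(i::nat) (d::nat). if d = 1 then (if i = 1 then dquot_poly (p * Pe) \<zeta> else dquot_poly (p * Po) \<zeta>)
    else (if i = 1 then dquot_poly ([:0, 1:] * (p * Po)) \<zeta> else dquot_poly (p * Pe) \<zeta>))"
  define g where "g = (\<lambda>a t. poly f (complex_of_real t) / (\<zeta> - complex_of_real t) * complex_of_real (w a t))"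
  define h where "h = (\<lambda>i d t. poly (f * D i d) (complex_of_real t) * dens (wc i) t)"
  have g: "set_integrable lebesgue \<Delta> (g a)" if "a \<in> {1,2}" for a
    unfolding g_def by (rule integrable_cauchy_w[OF that z])
  have h: "set_integrable lebesgue \<Delta> (h i d)" if "i \<in> {1,2}" for i d
    unfolding h_def by (rule integrable_poly_wc[OF that])
  have dens_part: "times_adj Pe Po \<zeta> (\<lambda>a. ?I (g a)) b
      = - times_adj Pe Po \<zeta> (\<lambda>d. ?I (h 1 d) + ?I (h 2 d)) b"
  proof -
    have pt: "times_adj Pe Po \<zeta> (\<lambda>d. g d t + (h 1 d t + h 2 d t)) b = 0" if "complex_of_real t \<notin> Z" for t
    proof -
      let ?x = "complex_of_real t"
      have ne: "?x \<noteq> \<zeta>" using that z by auto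
      let ?k = "1 / (\<zeta> - ?x)"
      have "times_adj Pe Po \<zeta> (\<lambda>d. g d t + (h 1 d t + h 2 d t)) b
        = times_adj Pe Po \<zeta> (\<lambda>d. ?k * (poly f ?x *
        (dens (wc 1) t * (if d = 1 then cpoly (p * Pe) \<zeta> else cpoly ([:0, 1:] * (p * Po)) \<zeta>)
        + dens (wc 2) t * (if d = 1 then cpoly (p * Po) \<zeta> else cpoly (p * Pe) \<zeta>)))) b"
      proof -
        have e: "q / k * (u * y + v * y') + (q * ((x - y) / k) * u + q * ((x' - y') / k) * v)
            = 1 / k * (q * (u * x + v * x'))" for q u v x x' y y' k :: complex
          by (simp add: divide_inverse algebra_simps)
        have "g 1 t + (h 1 1 t + h 2 1 t) = ?k * (poly f ?x *
            (dens (wc 1) t * cpoly (p * Pe) \<zeta> + dens (wc 2) t * cpoly (p * Po) \<zeta>))"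
          unfolding g_def h_def D_def poly_mult dens_wc_perturbation(1)[OF that, symmetric]
          using e by (simp add: dquot_poly_eq[OF ne] del: mult_pCons_left)
        moreover have "g 2 t + (h 1 2 t + h 2 2 t) = ?k * (poly f ?x *
            (dens (wc 1) t * cpoly ([:0, 1:] * (p * Po)) \<zeta> + dens (wc 2) t * cpoly (p * Pe) \<zeta>))"
          unfolding g_def h_def D_def poly_mult dens_wc_perturbation(2)[OF that, symmetric]
          using e by (simp add: dquot_poly_eq[OF ne] del: mult_pCons_left)
        ultimately show ?thesis by (simp add: times_adj_def)
      qed
      also have "\<dots> = 0"
        by (simp only: times_adj_mult times_adj_add times_adj_matrix_eq_0[OF z]) simp
      finally show ?thesis .
    qed
    have "times_adj Pe Po \<zeta> (\<lambda>d. ?I (g d) + (?I (h 1 d) + ?I (h 2 d))) b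
        = ?I (\<lambda>t. times_adj Pe Po \<zeta> (\<lambda>d. g d t + (h 1 d t + h 2 d t)) b)"
    proof -
      have int: "set_integrable lebesgue \<Delta> (\<lambda>t. g d t + (h 1 d t + h 2 d t))"
        "?I (\<lambda>t. g d t + (h 1 d t + h 2 d t)) = ?I (g d) + (?I (h 1 d) + ?I (h 2 d))"
        if "d \<in> {1,2}" for d
        using g h that by (simp_all add: set_integral_add)
      obtain \<alpha> \<beta> where T: "\<And>v. times_adj Pe Po \<zeta> v b = \<alpha> * v 1 + \<beta> * v 2"
        by (rule times_adj_coeffs[of Pe Po \<zeta> b]) blast
      have "?I (\<lambda>t. \<alpha> * (g 1 t + (h 1 1 t + h 2 1 t)) + \<beta> * (g 2 t + (h 1 2 t + h 2 2 t)))
        = \<alpha> * ?I (\<lambda>t. g 1 t + (h 1 1 t + h 2 1 t)) + \<beta> * ?I (\<lambda>t. g 2 t + (h 1 2 t + h 2 2 t))"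
        by (simp only: set_integral_add(2) set_integrable_mult_right set_integral_mult_right
            int(1) insertI1 insertI2)
      then show ?thesis unfolding T by (simp only: int(2) insertI1 insertI2)
    qed
    also have "\<dots> = ?I (\<lambda>t. 0)"
      by (rule set_integral_cong_off_finite(2)[OF finite_Z pt])
    also have "\<dots> = 0" by simp
    finally show ?thesis
      unfolding times_adj_add[of _ _ _ "\<lambda>d. ?I (g d)"] by (simp only: eq_neg_iff_add_eq_0)
  qed
  have V: "Vrow f \<zeta> d = (?I (h 1 d) + ?I (h 2 d)) + (\<Sum>\<eta>\<in>Z. poly f \<eta> * (if d = 1
      then c 1 \<eta> * poly (dquot_poly (p * Pe) \<zeta>) \<eta> + c 2 \<eta> * poly (dquot_poly (p * Po) \<zeta>) \<eta>
      else c 1 \<eta> * poly (dquot_poly ([:0, 1:] * (p * Po)) \<zeta>) \<eta> + c 2 \<eta> * poly (dquot_poly (p * Pe) \<zeta>) \<eta>))" for d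
    by (cases "d = 1") (simp_all add: Vrow_def mom_def wint_wc h_def D_def sum.distrib algebra_simps
        del: mult_pCons_left)
  have "times_adj Pe Po \<zeta> (Vrow f \<zeta>) b = times_adj Pe Po \<zeta> (\<lambda>d. ?I (h 1 d) + ?I (h 2 d)) b
      + (\<Sum>\<eta>\<in>Z. poly f \<eta> * (if \<eta> = \<zeta> then c b \<zeta> * cpoly (pderiv (pi_poly Pe Po * p)) \<zeta> else 0))"
    unfolding V[abs_def] times_adj_add times_adj_sum times_adj_mult
    by (rule arg_cong2[where f = "(+)", OF refl], rule sum.cong[OF refl]) (simp only: mass_term[OF z _ b])
  also have "(\<Sum>\<eta>\<in>Z. poly f \<eta> * (if \<eta> = \<zeta> then c b \<zeta> * cpoly (pderiv (pi_poly Pe Po * p)) \<zeta> else 0))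
      = (\<Sum>\<eta>\<in>Z. if \<eta> = \<zeta> then c b \<zeta> * cpoly (pderiv (pi_poly Pe Po * p)) \<zeta> * poly f \<zeta> else 0)"
    by (rule sum.cong) auto
  also have "\<dots> = c b \<zeta> * cpoly (pderiv (pi_poly Pe Po * p)) \<zeta> * poly f \<zeta>"
    using z finite_Z by simp
  finally show ?thesis
    unfolding Wlin_def using dens_part[unfolded g_def] by simp
qed

end

section \<open>The shift by the perturbing polynomial\<close>

lemma sum_even_odd:
  fixes F :: "nat \<Rightarrow> 'a :: comm_monoid_add"
  shows "(\<Sum>k<2 * K. F k) = (\<Sum>i<K. F (2 * i)) + (\<Sum>i<K. F (Suc (2 * i)))"
  by (induction K) (simp_all add: add_ac)

text \<open>The vector is read as a matrix with equal columns, so that associativity of the matrix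
  product applies.\<close>

lemma lower_inv_imat_vec:
  assumes "lower_unitriangular S"
  shows "imat_vec (lower_inv S) (imat_vec S v) = v"
proof -
  have v: "imat_vec A u = (\<lambda>i. imat_mult A (\<lambda>k _. u k) i j)" for A u and j :: nat
    by (simp add: imat_vec_def imat_mult_def)
  have "imat_vec (lower_inv S) (imat_vec S v)
      = (\<lambda>i. imat_mult (lower_inv S) (imat_mult S (\<lambda>k _. v k)) i 0)"
    by (subst v[where j = 0]) (rule arg_cong[where f = "\<lambda>B. (\<lambda>i. imat_mult (lower_inv S) B i 0)"],
        intro ext, subst v, rule refl)
  also have "\<dots> = v"
    by (simp add: imat_mult_assoc[symmetric] assms lower_inv imat_mult_one_left)
  finally show ?thesis .
qed

section \<open>Rows of a triangular matrix as polynomials, on which linear functionals can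
  act\<close>

definition bpoly :: "imat \<Rightarrow> nat \<Rightarrow> complex poly"
  where "bpoly S n = (\<Sum>i\<le>n. Polynomial.smult (S n i) ([:0, 1:] ^ i))"

lemma poly_bpoly:
  assumes "lower_unitriangular S"
  shows "poly (bpoly S n) = Bpol S n"
  by (rule ext) (simp add: Bpol_def bpoly_def imat_vec_lower[OF assms order_refl] Xvec_def poly_sum)

lemma smult_sum_right:
  "Polynomial.smult a (\<Sum>i\<in>I. f i) = (\<Sum>i\<in>I. Polynomial.smult a (f i))"
  by (induction I rule: infinite_finite_induct) (simp_all add: smult_add_right)

lemma bpoly_mult:
  assumes A: "lower_unitriangular A" and B: "lower_unitriangular B"
  shows "bpoly (imat_mult A B) n = (\<Sum>l\<le>n. Polynomial.smult (A n l) (bpoly B l))"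
proof -
  have "(\<Sum>l\<le>n. Polynomial.smult (A n l) (bpoly B l))
      = (\<Sum>l\<le>n. \<Sum>i\<le>n. Polynomial.smult (A n l * B l i) ([:0, 1:] ^ i))"
  proof (rule sum.cong[OF refl])
    fix l assume "l \<in> {..n}"
    then have "bpoly B l = (\<Sum>i\<le>n. Polynomial.smult (B l i) ([:0, 1:] ^ i))"
      unfolding bpoly_def using B
      by (intro sum.mono_neutral_left) (auto simp: lower_unitriangular_def)
    then show "Polynomial.smult (A n l) (bpoly B l)
        = (\<Sum>i\<le>n. Polynomial.smult (A n l * B l i) ([:0, 1:] ^ i))"
      by (simp add: smult_sum_right)
  qed
  also have "\<dots> = bpoly (imat_mult A B) n"
    unfolding bpoly_def imat_mult_lower[OF A order_refl]
    by (subst sum.swap) (simp add: smult_sum)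
  finally show ?thesis by simp
qed

section \<open>Parity decomposition of the perturbing polynomial and the resulting shifts\<close>

context geronimus
begin

definition Pt :: "real poly"
  where "Pt = pcompose p [:0, 0, 1:] * P"

lemma Pt_parts:
  "coeff Pt (2 * i) = coeff (p * Pe) i" "coeff Pt (Suc (2 * i)) = coeff (p * Po) i"
proof -
  have X: "[:0, 1:] * pcompose (p * Po) [:0, 0, 1:] = pCons 0 (pcompose (p * Po) [:0, 0, 1:])" by simp
  have "Pt = pcompose (p * Pe) [:0, 0, 1:] + [:0, 1:] * pcompose (p * Po) [:0, 0, 1:]"
    unfolding Pt_def by (subst parts) (simp add: pcompose_mult algebra_simps)
  then have "Pt = pcompose (p * Pe) [:0, 0, 1:] + pCons 0 (pcompose (p * Po) [:0, 0, 1:])"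
    unfolding X .
  moreover have "coeff (pCons 0 (pcompose (p * Po) [:0, 0, 1:])) (2 * i) = 0"
    using coeff_compose_square_odd[of "p * Po" "i - 1"] by (cases i) simp_all
  ultimately show "coeff Pt (2 * i) = coeff (p * Pe) i" "coeff Pt (Suc (2 * i)) = coeff (p * Po) i"
    by (simp_all add: coeff_compose_square_even coeff_compose_square_odd)
qed

lemma Pt_monic: "degree Pt = 2 * M + N" "coeff Pt (2 * M + N) = 1"
proof -
  have deg: "degree q = K" "lead_coeff q = 1"
    if "map_poly complex_of_real q = (\<Prod>j<K. [:- y j, 1:])" for q K y
  proof -
    have d: "degree q = degree (map_poly complex_of_real q)" by (simp add: degree_map_poly)
    also have "\<dots> = K" unfolding that by (subst degree_prod_eq_sum_degree) auto
    finally show "degree q = K" .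
    have "complex_of_real (lead_coeff q) = lead_coeff (map_poly complex_of_real q)"
      by (simp add: coeff_map_poly flip: d)
    also have "\<dots> = 1" unfolding that by (simp add: lead_coeff_prod)
    finally show "lead_coeff q = 1" by simp
  qed
  note P = deg[OF P_roots] and p = deg[OF p_roots]
  have ne: "P \<noteq> 0" "p \<noteq> 0" using P p by auto
  have pc: "degree (pcompose p [:0, 0, 1:]) = 2 * M" using p by (simp add: degree_pcompose)
  have lc: "lead_coeff (pcompose p [:0, 0, 1:]) = 1" using p by (simp add: lead_coeff_comp)
  then have "pcompose p [:0, 0, 1:] \<noteq> 0" by auto
  then show d: "degree Pt = 2 * M + N" using ne P pc by (simp add: Pt_def degree_mult_eq)
  have "lead_coeff Pt = 1" unfolding Pt_def lead_coeff_mult lc P(2) by simp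
  then show "coeff Pt (2 * M + N) = 1" using d by simp
qed

text \<open>The two parts occupy coefficients of \<open>Pt\<close> of different parity, so no
  cancellation occurs and the degree of \<open>Pt\<close> bounds both.\<close>

lemma degree_parts:
  "2 * degree (p * Pe) \<le> 2 * M + N" "p * Po \<noteq> 0 \<Longrightarrow> 2 * degree (p * Po) + 1 \<le> 2 * M + N"
proof -
  show "2 * degree (p * Pe) \<le> 2 * M + N"
  proof (cases "p * Pe = 0")
    case True
    show ?thesis unfolding True by simp
  next
    case False
    then have "coeff Pt (2 * degree (p * Pe)) \<noteq> 0" unfolding Pt_parts by simp
    from le_degree[OF this] show ?thesis by (simp add: Pt_monic)
  qed
  show "2 * degree (p * Po) + 1 \<le> 2 * M + N" if "p * Po \<noteq> 0"
  proof -
    have "coeff Pt (Suc (2 * degree (p * Po))) \<noteq> 0" unfolding Pt_parts using that by simp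
    from le_degree[OF this] show ?thesis by (simp add: Pt_monic)
  qed
qed

lemma Pt_shift:
  "(\<Sum>k\<le>2 * M + N. complex_of_real (coeff Pt k) * u k)
    = (\<Sum>i<Suc (2 * M + N). complex_of_real (coeff (p * Pe) i) * u (2 * i))
      + (\<Sum>i<Suc (2 * M + N). complex_of_real (coeff (p * Po) i) * u (Suc (2 * i)))"
proof -
  have "(\<Sum>k\<le>2 * M + N. complex_of_real (coeff Pt k) * u k)
      = (\<Sum>k<2 * Suc (2 * M + N). complex_of_real (coeff Pt k) * u k)"
    by (rule sum.mono_neutral_left) (auto simp: Pt_monic(1) intro!: coeff_eq_0)
  then show ?thesis unfolding sum_even_odd Pt_parts .
qed

lemma coeff_parts_eq_0:
  assumes "Suc (2 * M + N) \<le> i"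
  shows "coeff (p * Pe) i = 0" "coeff (p * Po) i = 0"
  unfolding Pt_parts[symmetric] using assms by (auto simp: Pt_monic(1) intro!: coeff_eq_0)

text \<open>The functionals \<open>f \<mapsto> \<integral> f (X\<^sub>1 u\<^sub>1 + X\<^sub>2 u\<^sub>2)\<^sub>j\<close> for the original and the perturbed pair of weights \<open>u\<close>.\<close>

definition lw :: "nat \<Rightarrow> complex poly \<Rightarrow> complex"
  where "lw j f = wmom (if even j then 1 else 2) (f * [:0, 1:] ^ (j div 2))"

definition lmom :: "nat \<Rightarrow> complex poly \<Rightarrow> complex"
  where "lmom j f = mom (if even j then 1 else 2) (f * [:0, 1:] ^ (j div 2))"

lemma lw_sum: "lw j (\<Sum>i\<in>I. Polynomial.smult (u i) (f i)) = (\<Sum>i\<in>I. u i * lw j (f i))"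
  unfolding lw_def sum_distrib_right mult_smult_left by (rule wmom_sum) auto

lemma lmom_sum: "lmom j (\<Sum>i\<in>I. Polynomial.smult (u i) (f i)) = (\<Sum>i\<in>I. u i * lmom j (f i))"
  unfolding lmom_def sum_distrib_right mult_smult_left by (rule mom_sum) auto

lemma Xcomp_cases: "Xcomp 1 z j = (if even j then z ^ (j div 2) else 0)"
  "Xcomp 2 z j = (if even j then 0 else z ^ (j div 2))"
  by (auto simp: Xcomp_def even_iff_mod_2_eq_zero odd_iff_mod_2_eq_one)

lemma wint_0: "wint \<Delta> u (\<lambda>z. 0) = 0"
  by (simp add: wint_def)

lemma moment_matrix_w: "moment_matrix \<Delta> (\<lambda>a. fun_weight (w a)) i j = lw j ([:0, 1:] ^ i)"
  unfolding moment_matrix_def lw_def wmom_def Xcomp_cases Xvec_def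
  by (auto simp: Xcomp_cases[simplified] wint_0 fun_eq_iff intro!: arg_cong[where f = "wint \<Delta> _"])

lemma moment_matrix_wc: "moment_matrix \<Delta> wc i j = lmom j ([:0, 1:] ^ i)"
  unfolding moment_matrix_def lmom_def mom_def Xcomp_cases Xvec_def
  by (auto simp: Xcomp_cases[simplified] wint_0 fun_eq_iff intro!: arg_cong[where f = "wint \<Delta> _"])

text \<open>The functionals alternate between the two weights and gain a power of \<open>x\<close>
  every second step. In this interleaving the perturbing matrix acts as a shift of the index with
  the coefficients of \<open>Pt\<close>.\<close>

lemma lw_eq_lmom:
  "lw j f = (\<Sum>k\<le>2 * M + N. complex_of_real (coeff Pt k) * lmom (j + k) f)"
proof -
  let ?c = "map_poly complex_of_real"
  obtain i where j: "j = 2 * i \<or> j = Suc (2 * i)" by (metis evenE oddE Suc_eq_plus1)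
  have z: "coeff (?c (p * Pe)) k = 0" "coeff (?c (p * Po)) k = 0" if "Suc (2 * M + N) \<le> k" for k
    using coeff_parts_eq_0[OF that] by (simp_all add: coeff_map_poly)
  have m: "mom 1 (g * ?c (p * Pe)) = (\<Sum>k<Suc (2 * M + N). complex_of_real (coeff (p * Pe) k) * mom 1 (g * [:0, 1:] ^ k))"
    "mom 2 (g * ?c (p * Pe)) = (\<Sum>k<Suc (2 * M + N). complex_of_real (coeff (p * Pe) k) * mom 2 (g * [:0, 1:] ^ k))"
    "mom 1 (g * ?c (p * Po)) = (\<Sum>k<Suc (2 * M + N). complex_of_real (coeff (p * Po) k) * mom 1 (g * [:0, 1:] ^ k))"
    "mom 2 (g * ?c (p * Po)) = (\<Sum>k<Suc (2 * M + N). complex_of_real (coeff (p * Po) k) * mom 2 (g * [:0, 1:] ^ k))"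
    for g by (subst mom_mult_poly[of _ "Suc (2 * M + N)"]; use z in \<open>simp add: coeff_map_poly\<close>)+
  from j show ?thesis
  proof
    assume j: "j = 2 * i"
    have L: "lmom (2 * i + 2 * k) f = mom 1 (f * [:0, 1:] ^ i * [:0, 1:] ^ k)"
      "lmom (2 * i + Suc (2 * k)) f = mom 2 (f * [:0, 1:] ^ i * [:0, 1:] ^ k)" for k
      by (simp_all add: lmom_def mult.assoc flip: power_add)
    have "lw j f = wmom 1 (f * [:0, 1:] ^ i)" by (simp add: lw_def j)
    also have "\<dots> = (\<Sum>k\<le>2 * M + N. complex_of_real (coeff Pt k) * lmom (j + k) f)"
      unfolding wmom_eq_mom m Pt_shift j L ..
    finally show ?thesis .
  next
    assume j: "j = Suc (2 * i)"
    \<comment> \<open>For odd \<open>j\<close> an odd shift reaches the next even index, which costs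
      one more factor \<open>x\<close>: this accounts for the \<open>x\<close> in the upper right
      entry of the matrix.\<close>
    have L: "lmom (Suc (2 * i) + 2 * k) f = mom 2 (f * [:0, 1:] ^ i * [:0, 1:] ^ k)"
      "lmom (Suc (2 * i) + Suc (2 * k)) f = mom 1 (f * [:0, 1:] ^ Suc i * [:0, 1:] ^ k)" for k
      by (simp_all add: lmom_def mult.assoc flip: power_add power_Suc
          del: mult_pCons_left mult_pCons_right)
    have X: "g * ?c ([:0, 1:] * q) = g * [:0, 1:] * ?c q" for q g
      by (simp add: map_poly_of_real_pCons)
    have "lw j f = wmom 2 (f * [:0, 1:] ^ i)" by (simp add: lw_def j)
    also have "\<dots> = mom 1 (f * [:0, 1:] ^ Suc i * ?c (p * Po)) + mom 2 (f * [:0, 1:] ^ i * ?c (p * Pe))"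
      unfolding wmom_eq_mom X power_Suc2 mult.assoc ..
    also have "\<dots> = (\<Sum>k\<le>2 * M + N. complex_of_real (coeff Pt k) * lmom (j + k) f)"
      unfolding m Pt_shift j L by (rule add.commute)
    finally show ?thesis .
  qed
qed

text \<open>An even shift multiplies both components by a power of \<open>y\<close>; an odd shift
  also swaps them, with an extra \<open>y\<close> on one side.\<close>

lemma Xcomp_shift:
  "(\<Sum>k\<le>2 * M + N. complex_of_real (coeff Pt k) * Xcomp 1 y (j + k))
    = cpoly (p * Pe) y * Xcomp 1 y j + y * cpoly (p * Po) y * Xcomp 2 y j"
  "(\<Sum>k\<le>2 * M + N. complex_of_real (coeff Pt k) * Xcomp 2 y (j + k))
    = cpoly (p * Po) y * Xcomp 1 y j + cpoly (p * Pe) y * Xcomp 2 y j"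
proof -
  have ev: "cpoly q y = (\<Sum>i<Suc (2 * M + N). complex_of_real (coeff q i) * y ^ i)"
    if "\<And>i. Suc (2 * M + N) \<le> i \<Longrightarrow> coeff q i = 0" for q
  proof -
    have "cpoly q y = (\<Sum>i\<le>degree q. complex_of_real (coeff q i) * y ^ i)"
      by (simp add: poly_altdef degree_map_poly coeff_map_poly)
    also have "\<dots> = (\<Sum>i<Suc (2 * M + N). complex_of_real (coeff q i) * y ^ i)"
    proof (cases "q = 0")
      case False
      then have "degree q < Suc (2 * M + N)" using that leading_coeff_0_iff not_le by blast
      then show ?thesis by (intro sum.mono_neutral_left) (auto intro!: coeff_eq_0)
    qed simp
    finally show ?thesis .
  qed
  have e: "cpoly (p * Pe) y = (\<Sum>i<Suc (2 * M + N). complex_of_real (coeff (p * Pe) i) * y ^ i)"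
    "cpoly (p * Po) y = (\<Sum>i<Suc (2 * M + N). complex_of_real (coeff (p * Po) i) * y ^ i)"
    by (rule ev, rule coeff_parts_eq_0, assumption)+
  have "Xcomp 1 y (j + 2 * i) = y ^ i * Xcomp 1 y j" "Xcomp 2 y (j + 2 * i) = y ^ i * Xcomp 2 y j"
    "Xcomp 1 y (j + Suc (2 * i)) = y ^ i * (y * Xcomp 2 y j)"
    "Xcomp 2 y (j + Suc (2 * i)) = y ^ i * Xcomp 1 y j" for i
    unfolding Xcomp_cases by (auto simp: power_add mult_ac elim!: evenE oddE)
  then show "(\<Sum>k\<le>2 * M + N. complex_of_real (coeff Pt k) * Xcomp 1 y (j + k))
    = cpoly (p * Pe) y * Xcomp 1 y j + y * cpoly (p * Po) y * Xcomp 2 y j"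
    "(\<Sum>k\<le>2 * M + N. complex_of_real (coeff Pt k) * Xcomp 2 y (j + k))
    = cpoly (p * Po) y * Xcomp 1 y j + cpoly (p * Pe) y * Xcomp 2 y j"
    unfolding Pt_shift e by (simp_all only: sum_distrib_left sum_distrib_right mult_ac add_ac)
qed

text \<open>A difference quotient has degree one less than \<open>R\<close>, and
  \<open>degree_parts\<close> then keeps every index of \<open>lmom\<close> that occurs below
  \<open>2 * M + N\<close>.\<close>

lemma Vrow_eq_0:
  assumes "\<And>j. j < 2 * M + N \<Longrightarrow> lmom j f = 0"
  shows "Vrow f \<zeta> d = 0"
proof -
  \<comment> \<open>The second alternative covers constant \<open>R\<close>, where the difference
    quotient is zero and the truncated subtraction says nothing.\<close>
  have m1: "mom 1 (f * dquot_poly R \<zeta>) = 0" if "2 * (degree R - 1) < 2 * M + N \<or> degree R = 0" for R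
  proof -
    have "mom 1 (f * dquot_poly R \<zeta>) = (\<Sum>i<degree R. coeff (dquot_poly R \<zeta>) i * mom 1 (f * [:0, 1:] ^ i))"
      by (rule mom_mult_poly) (auto intro: coeff_dquot_poly_eq_0)
    also have "mom 1 (f * [:0, 1:] ^ i) = 0" if "i < degree R" for i
      using assms[of "2 * i"] that \<open>_ \<or> _\<close> by (auto simp: lmom_def)
    then have "(\<Sum>i<degree R. coeff (dquot_poly R \<zeta>) i * mom 1 (f * [:0, 1:] ^ i)) = 0" by simp
    finally show ?thesis .
  qed
  have m2: "mom 2 (f * dquot_poly R \<zeta>) = 0" if "2 * degree R \<le> 2 * M + N" for R
  proof -
    have "mom 2 (f * dquot_poly R \<zeta>) = (\<Sum>i<degree R. coeff (dquot_poly R \<zeta>) i * mom 2 (f * [:0, 1:] ^ i))"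
      by (rule mom_mult_poly) (auto intro: coeff_dquot_poly_eq_0)
    also have "mom 2 (f * [:0, 1:] ^ i) = 0" if "i < degree R" for i
      using assms[of "Suc (2 * i)"] that \<open>2 * degree R \<le> _\<close> by (auto simp: lmom_def)
    then have "(\<Sum>i<degree R. coeff (dquot_poly R \<zeta>) i * mom 2 (f * [:0, 1:] ^ i)) = 0" by simp
    finally show ?thesis .
  qed
  have dX: "degree ([:0, 1:] * q) = (if q = 0 then 0 else Suc (degree q))" for q :: "real poly"
    by (simp add: degree_pCons_eq_if)
  have "mom 1 (f * dquot_poly (p * Pe) \<zeta>) = 0" by (rule m1) (use degree_parts(1) in auto)
  moreover have "mom 2 (f * dquot_poly (p * Pe) \<zeta>) = 0" by (rule m2) (rule degree_parts)
  moreover have "mom 2 (f * dquot_poly (p * Po) \<zeta>) = 0"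
  proof (rule m2)
    show "2 * degree (p * Po) \<le> 2 * M + N"
    proof (cases "p * Po = 0")
      case True
      show ?thesis unfolding True by simp
    next
      case False
      from degree_parts(2)[OF this] show ?thesis by linarith
    qed
  qed
  moreover have "mom 1 (f * dquot_poly ([:0, 1:] * (p * Po)) \<zeta>) = 0"
    by (rule m1) (unfold dX, use degree_parts(2) in \<open>cases "p * Po = 0"; simp\<close>)
  ultimately show ?thesis by (simp only: Vrow_def) simp
qed

end

section \<open>Connection formulas\<close>

locale geronimus_LU = geronimus +
  fixes S St Sc Stc :: imat and H Hc :: ivec
  assumes LU: "LU_factorization (moment_matrix \<Delta> (\<lambda>a. fun_weight (w a))) S H St"
    and LU_perturbed: "LU_factorization (moment_matrix \<Delta> wc) Sc Hc Stc"
begin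

abbreviation "Nt \<equiv> 2 * M + N"

definition Om :: imat
  where "Om = imat_mult Sc (lower_inv S)"

lemma lower: "lower_unitriangular S" "lower_unitriangular St" "lower_unitriangular Sc"
  "lower_unitriangular Stc"
  using LU LU_perturbed by (simp_all add: LU_factorization_def)

lemma H_nonzero: "H n \<noteq> 0" "Hc n \<noteq> 0"
  using LU LU_perturbed by (simp_all add: LU_factorization_def)

lemma lower_Om: "lower_unitriangular Om"
  unfolding Om_def by (intro lower_unitriangular_mult lower lower_inv(1))

lemma bpoly_Sc: "bpoly Sc n = (\<Sum>l\<le>n. Polynomial.smult (Om n l) (bpoly S l))"
proof -
  have "imat_mult Om S = Sc"
    unfolding Om_def by (subst imat_mult_assoc) (simp_all add: lower lower_inv imat_mult_one_right)
  then show ?thesis using bpoly_mult[OF lower_Om lower(1), of n] by simp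
qed

lemma lw_bpoly: "lw j (bpoly S n) = H n * lower_inv St j n"
  unfolding bpoly_def lw_sum moment_matrix_w[symmetric] by (rule LU_mult_left[OF LU])

lemma lmom_bpoly: "lmom j (bpoly Sc n) = Hc n * lower_inv Stc j n"
  unfolding bpoly_def lmom_sum moment_matrix_wc[symmetric] by (rule LU_mult_left[OF LU_perturbed])

text \<open>Both sides pair the perturbed polynomial with the original functionals combined by row
  \<open>l\<close> of \<open>St\<close>. The original factorization isolates one entry of
  \<open>Om\<close>; the shift expresses the same pairing through the perturbed
  factorization.\<close>

lemma Om_eq:
  "Om n l * H l = (\<Sum>j\<le>l. St l j * (\<Sum>k\<le>Nt. complex_of_real (coeff Pt k) * (Hc n * lower_inv Stc (j + k) n)))"
proof -
  have "(\<Sum>j\<le>l. St l j * lw j (bpoly Sc n)) = (\<Sum>j\<le>l. St l j * (\<Sum>k\<le>n. Om n k * (H k * lower_inv St j k)))"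
    by (simp add: bpoly_Sc lw_sum lw_bpoly)
  also have "\<dots> = (\<Sum>k\<le>n. Om n k * H k * (\<Sum>j\<le>l. St l j * lower_inv St j k))"
    by (simp add: sum_distrib_left mult_ac) (rule sum.swap)
  also have "\<dots> = (\<Sum>k\<le>n. Om n k * H k * imat_one l k)"
    unfolding imat_mult_lower[OF lower(2) order_refl, symmetric] lower_inv(2)[OF lower(2)] ..
  also have "\<dots> = (\<Sum>k\<le>n. if k = l then Om n k * H k else 0)"
    by (rule sum.cong) (auto simp: imat_one_def)
  also have "\<dots> = Om n l * H l"
    using lower_Om by (auto simp: lower_unitriangular_def)
  finally show ?thesis unfolding lw_eq_lmom lmom_bpoly by simp
qed

text \<open>All indices \<open>j + k\<close> in \<open>Om_eq\<close> are at most
  \<open>l + Nt\<close>, hence below \<open>n\<close>, where column \<open>n\<close> of the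
  triangular inverse vanishes.\<close>

lemma Om_band:
  assumes "l + Nt < n"
  shows "Om n l = 0"
proof -
  have "Om n l * H l = 0"
    unfolding Om_eq using assms lower_inv(1)[OF lower(4)]
    by (intro sum.neutral ballI) (auto simp: lower_unitriangular_def intro!: sum.neutral)
  then show ?thesis using H_nonzero by simp
qed

text \<open>Only \<open>j = l\<close> and \<open>k = Nt\<close> survive in \<open>Om_eq\<close>.
  Since \<open>Pt\<close> is monic, the entry times \<open>H l\<close> is
  \<open>Hc (l + Nt)\<close>.\<close>

lemma Om_band_edge: "Om (l + Nt) l \<noteq> 0"
proof -
  have L: "lower_inv Stc i n = 0" if "i < n" for i n
    using that lower_inv(1)[OF lower(4)] by (auto simp: lower_unitriangular_def)
  have "Om (l + Nt) l * H l = (\<Sum>j\<le>l. if j = l then St l j * Hc (l + Nt) else 0)"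
    unfolding Om_eq
  proof (rule sum.cong[OF refl])
    fix j assume j: "j \<in> {..l}"
    have "(\<Sum>k\<le>Nt. complex_of_real (coeff Pt k) * (Hc (l + Nt) * lower_inv Stc (j + k) (l + Nt)))
        = (\<Sum>k\<le>Nt. if k = Nt then (if j = l then Hc (l + Nt) else 0) else 0)"
    proof (rule sum.cong[OF refl])
      fix k assume k: "k \<in> {..Nt}"
      show "complex_of_real (coeff Pt k) * (Hc (l + Nt) * lower_inv Stc (j + k) (l + Nt))
          = (if k = Nt then (if j = l then Hc (l + Nt) else 0) else 0)"
      proof (cases "k = Nt \<and> j = l")
        case True
        then show ?thesis using lower_inv(1)[OF lower(4)] Pt_monic by (auto simp: lower_unitriangular_def)
      next
        case False
        then have "j + k < l + Nt" using j k by auto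
        then show ?thesis using False by (auto simp: L)
      qed
    qed
    then show "St l j * (\<Sum>k\<le>Nt. complex_of_real (coeff Pt k) * (Hc (l + Nt) * lower_inv Stc (j + k) (l + Nt)))
        = (if j = l then St l j * Hc (l + Nt) else 0)" by simp
  qed
  also have "\<dots> = Hc (l + Nt)" using lower(2) by (simp add: lower_unitriangular_def)
  finally show ?thesis using H_nonzero by auto
qed

text \<open>After inserting \<open>Om_eq\<close>, the factors \<open>Hc m\<close> cancel and the sum
  over \<open>m\<close> multiplies \<open>Stc\<close> by its inverse. The range
  \<open>m \<le> l + Nt\<close> is long enough for every row \<open>j + k\<close> that
  occurs.\<close>

lemma Om_transpose_Apol:
  "(\<Sum>m\<le>l + Nt. Om m l * Apol Stc Hc a m y)
    = inverse (H l) * (\<Sum>j\<le>l. St l j * (\<Sum>k\<le>Nt. complex_of_real (coeff Pt k) * Xcomp a y (j + k)))"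
proof -
  let ?v = "imat_vec Stc (Xcomp a y)"
  have cancel: "Hc m * (inverse (Hc m) * u) = u" for m u
    using H_nonzero by simp
  have "H l * (\<Sum>m\<le>l + Nt. Om m l * Apol Stc Hc a m y)
      = (\<Sum>m\<le>l + Nt. (Om m l * H l) * Apol Stc Hc a m y)"
    by (simp add: sum_distrib_left mult_ac)
  also have "\<dots> = (\<Sum>m\<le>l + Nt. \<Sum>j\<le>l. \<Sum>k\<le>Nt.
      St l j * (complex_of_real (coeff Pt k) * (lower_inv Stc (j + k) m * ?v m)))"
    unfolding Om_eq Apol_def by (simp add: sum_distrib_left sum_distrib_right cancel mult_ac)
  also have "\<dots> = (\<Sum>j\<le>l. \<Sum>k\<le>Nt. \<Sum>m\<le>l + Nt.
      St l j * (complex_of_real (coeff Pt k) * (lower_inv Stc (j + k) m * ?v m)))"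
    by (subst sum.swap) (intro sum.cong refl sum.swap)
  also have "\<dots> = (\<Sum>j\<le>l. \<Sum>k\<le>Nt. St l j * (complex_of_real (coeff Pt k) * Xcomp a y (j + k)))"
  proof (intro sum.cong refl)
    fix j k assume "j \<in> {..l}" "k \<in> {..Nt}"
    then have "j + k \<le> l + Nt" by simp
    from imat_vec_lower[OF lower_inv(1)[OF lower(4)] this, of ?v]
    have "(\<Sum>m\<le>l + Nt. lower_inv Stc (j + k) m * ?v m) = Xcomp a y (j + k)"
      by (simp add: lower_inv_imat_vec[OF lower(4)])
    then show "(\<Sum>m\<le>l + Nt. St l j * (complex_of_real (coeff Pt k) * (lower_inv Stc (j + k) m * ?v m)))
        = St l j * (complex_of_real (coeff Pt k) * Xcomp a y (j + k))"
      by (simp flip: sum_distrib_left)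
  qed
  finally have "H l * (\<Sum>m\<le>l + Nt. Om m l * Apol Stc Hc a m y)
      = (\<Sum>j\<le>l. St l j * (\<Sum>k\<le>Nt. complex_of_real (coeff Pt k) * Xcomp a y (j + k)))"
    by (simp add: sum_distrib_left)
  then show ?thesis using H_nonzero by (simp add: field_simps)
qed

lemma Apol_connection:
  "cpoly (p * Pe) y * Apol St H 1 l y + y * cpoly (p * Po) y * Apol St H 2 l y
    = (\<Sum>m\<le>l + Nt. Om m l * Apol Stc Hc 1 m y)"
  "cpoly (p * Po) y * Apol St H 1 l y + cpoly (p * Pe) y * Apol St H 2 l y
    = (\<Sum>m\<le>l + Nt. Om m l * Apol Stc Hc 2 m y)"
  unfolding Om_transpose_Apol Xcomp_shift
  unfolding Apol_def imat_vec_lower[OF lower(2) order_refl]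
  by (simp_all add: sum_distrib_left sum.distrib algebra_simps)

section \<open>Linear relations among the rows of second kind functions and the kernel row\<close>

lemma Wfun_eq_Wlin: "Wfun \<Delta> w Pe Po p c S b l \<zeta> = Wlin (bpoly S l) b \<zeta>"
  by (simp add: Wfun_def Wlin_def Cfun_def wint_fun_weight poly_bpoly[OF lower(1)])

lemma sum_Om_Wfun:
  assumes "\<zeta> \<in> Z"
  shows "(\<Sum>l\<le>m. Om m l * Wfun \<Delta> w Pe Po p c S b l \<zeta>) = Wlin (bpoly Sc m) b \<zeta>"
  unfolding bpoly_Sc Wlin_sum[OF assms] Wfun_eq_Wlin ..

text \<open>The sum is \<open>Wlin\<close> of the perturbed polynomial of index \<open>m\<close>;
  this polynomial is orthogonal to the first \<open>Nt\<close> perturbed functionals, so its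
  \<open>Vrow\<close> vanishes.\<close>

lemma Om_Wfun_eq_0:
  assumes "\<zeta> \<in> Z" "b \<in> {1,2}" "Nt \<le> m"
  shows "(\<Sum>l\<le>m. Om m l * Wfun \<Delta> w Pe Po p c S b l \<zeta>) = 0"
proof -
  have "lmom j (bpoly Sc m) = 0" if "j < Nt" for j
    unfolding lmom_bpoly using that assms(3) lower_inv(1)[OF lower(4)]
    by (auto simp: lower_unitriangular_def)
  then show ?thesis
    unfolding sum_Om_Wfun[OF assms(1)] Wlin_eq_Vrow[OF assms(1,2)]
    by (simp add: times_adj_def Vrow_eq_0)
qed

text \<open>For fixed \<open>y\<close> the kernel is a polynomial \<open>f\<close> in
  \<open>t\<close>, and \<open>Pker\<close> is its \<open>Vrow\<close> times the adjugate.\<close>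

lemma Pker_eq:
  assumes "\<zeta> \<in> Z" "b \<in> {1,2}"
  shows "Pker \<Delta> wc Pe Po p Sc Hc Stc n a b \<zeta> y
    = - (\<Sum>l<n. Apol Stc Hc a l y * Wlin (bpoly Sc l) b \<zeta>)"
proof -
  define f where "f = (\<Sum>l<n. Polynomial.smult (Apol Stc Hc a l y) (bpoly Sc l))"
  have V: "Vker \<Delta> wc Sc Hc Stc n a i R \<zeta> y = mom i (f * dquot_poly R \<zeta>)" for i R
    unfolding Vker_def mom_def diff_quot_eq_poly
    by (rule arg_cong[where f = "wint _ _"], rule ext)
      (simp add: f_def poly_sum poly_bpoly[OF lower(3)] mult.commute)
  have "Pker \<Delta> wc Pe Po p Sc Hc Stc n a b \<zeta> y = times_adj Pe Po \<zeta> (Vrow f \<zeta>) b"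
    unfolding Pker_def Let_def V
    by (rule arg_cong[where f = "\<lambda>v. times_adj Pe Po \<zeta> v b"], rule ext) (simp only: Vrow_def)
  also have "\<dots> = - Wlin f b \<zeta>" unfolding Wlin_eq_Vrow[OF assms] by simp
  finally show ?thesis unfolding f_def Wlin_sum[OF assms(1)] .
qed

text \<open>The connection formula turns the first sum of \<open>kappa\<close> into one over all
  \<open>m < n + Nt\<close>, and \<open>Pker\<close> removes the part \<open>m < n\<close>. For the
  remaining \<open>m\<close> the band of \<open>Om\<close> leaves only \<open>l\<close> from
  \<open>n - Nt\<close> on.\<close>

lemma kappa_eq:
  assumes z: "\<zeta> \<in> Z" and b: "b \<in> {1,2}" and a: "a \<in> {1,2}" and n: "Nt \<le> n"
  shows "kappa \<Delta> w wc Pe Po p c S H St Sc Hc Stc n a b \<zeta> y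
    = (\<Sum>i<Nt. (\<Sum>m = n..<n + Nt. Om m (n - Nt + i) * Apol Stc Hc a m y)
        * Wfun \<Delta> w Pe Po p c S b (n - Nt + i) \<zeta>)"
proof -
  define W where "W = (\<lambda>l. Wfun \<Delta> w Pe Po p c S b l \<zeta>)"
  define A where "A = (\<lambda>m. Apol Stc Hc a m y)"
  have conn: "(if a = 1 then cpoly (p * Pe) y * Apol St H 1 l y + y * cpoly (p * Po) y * Apol St H 2 l y
      else cpoly (p * Po) y * Apol St H 1 l y + cpoly (p * Pe) y * Apol St H 2 l y)
      = (\<Sum>m<n + Nt. Om m l * A m)" if "l < n" for l
  proof -
    have "(if a = 1 then cpoly (p * Pe) y * Apol St H 1 l y + y * cpoly (p * Po) y * Apol St H 2 l y
      else cpoly (p * Po) y * Apol St H 1 l y + cpoly (p * Pe) y * Apol St H 2 l y)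
      = (\<Sum>m\<le>l + Nt. Om m l * A m)"
      using a unfolding A_def Apol_connection by auto
    also have "\<dots> = (\<Sum>m<n + Nt. Om m l * A m)"
      by (rule sum.mono_neutral_left) (use that in \<open>auto simp: Om_band\<close>)
    finally show ?thesis .
  qed
  have "kappa \<Delta> w wc Pe Po p c S H St Sc Hc Stc n a b \<zeta> y
      = (\<Sum>l<n. (\<Sum>m<n + Nt. Om m l * A m) * W l) - (\<Sum>m<n. A m * (\<Sum>l\<le>m. Om m l * W l))"
    unfolding kappa_def Let_def Pker_eq[OF z b] sum_Om_Wfun[OF z, symmetric]
    using conn by (simp add: W_def A_def)
  also have "(\<Sum>m<n. A m * (\<Sum>l\<le>m. Om m l * W l)) = (\<Sum>m<n. A m * (\<Sum>l<n. Om m l * W l))"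
    by (intro sum.cong refl arg_cong2[where f = "(*)"] sum.mono_neutral_left)
      (use lower_Om in \<open>auto simp: lower_unitriangular_def\<close>)
  also have "\<dots> = (\<Sum>l<n. (\<Sum>m<n. Om m l * A m) * W l)"
    by (simp add: sum_distrib_left sum_distrib_right mult_ac) (rule sum.swap)
  also have "(\<Sum>l<n. (\<Sum>m<n + Nt. Om m l * A m) * W l) - \<dots> = (\<Sum>l<n. (\<Sum>m = n..<n + Nt. Om m l * A m) * W l)"
  proof -
    have "(\<Sum>m<n + Nt. Om m l * A m) = (\<Sum>m<n. Om m l * A m) + (\<Sum>m = n..<n + Nt. Om m l * A m)" for l
      using sum.atLeastLessThan_concat[of 0 n "n + Nt" "\<lambda>m. Om m l * A m"] by (simp add: atLeast0LessThan)
    then show ?thesis by (simp add: sum_subtractf[symmetric] algebra_simps)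
  qed
  also have "\<dots> = (\<Sum>l = n - Nt..<n. (\<Sum>m = n..<n + Nt. Om m l * A m) * W l)"
    by (rule sum.mono_neutral_right) (auto simp: Om_band intro!: sum.neutral)
  also have "\<dots> = (\<Sum>i<Nt. (\<Sum>m = n..<n + Nt. Om m (n - Nt + i) * A m) * W (n - Nt + i))"
    using n by (intro sum.reindex_bij_witness[of _ "\<lambda>i. n - Nt + i" "\<lambda>l. l - (n - Nt)"]) auto
  finally show ?thesis unfolding A_def W_def .
qed

text \<open>Each column evaluates at one weight index and one node, the same for every
  \<open>F\<close>; identities at the nodes thus become identities of rows.\<close>

lemma node_row_cases:
  assumes "j < Nt"
  obtains b \<zeta> where "b \<in> {1,2}" "\<zeta> \<in> Z" "\<And>F. node_row M r xs F j = F b \<zeta>"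
proof -
  consider "j < M" | "M \<le> j" "j < 2 * M" | "2 * M \<le> j" by linarith
  then show thesis
  proof cases
    case 1
    then show thesis by (intro that[of 1 "(r j)\<^sup>2"]) (auto simp: node_row_def Z)
  next
    case 2
    then show thesis by (intro that[of 2 "(r (j - M))\<^sup>2"]) (auto simp: node_row_def Z)
  next
    case 3
    then show thesis using assms by (intro that[of 2 "(xs (j - 2 * M))\<^sup>2"]) (auto simp: node_row_def Z)
  qed
qed

section \<open>The determinant formulas by row operations\<close>

lemma christoffel_formulas:
  fixes n :: nat
  defines "Wrow \<equiv> \<lambda>l. node_row M r xs (\<lambda>b z. Wfun \<Delta> w Pe Po p c S b l z)"
    and "kapparow \<equiv> \<lambda>a y. node_row M r xs (\<lambda>b z. kappa \<Delta> w wc Pe Po p c S H St Sc Hc Stc n a b z y)"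
  assumes Nt: "1 \<le> Nt" and n: "Nt \<le> n" and tau: "tau Nt Wrow n \<noteq> 0"
  shows "a \<in> {1,2} \<Longrightarrow> Apol Stc Hc a n y = - (1 / tau Nt Wrow (n + 1)) *
      det_of Nt (\<lambda>i j. if i < Nt - 1 then Wrow (n - Nt + 1 + i) j else kapparow a y j)"
    and "Bpol Sc n x = 1 / tau Nt Wrow n *
      det_of (Nt + 1) (\<lambda>i j. if j < Nt then Wrow (n - Nt + i) j else Bpol S (n - Nt + i) x)"
proof -
  define V where "V = (\<lambda>i j. Wrow (n - Nt + i) j)"
  have tauV: "tau Nt Wrow n = det_of Nt V" by (simp add: tau_def V_def)
  have shift: "(\<Sum>l\<le>n. Om n l * F l) = (\<Sum>i\<le>Nt. Om n (n - Nt + i) * F (n - Nt + i))" for F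
  proof -
    have "(\<Sum>l\<le>n. Om n l * F l) = (\<Sum>l = n - Nt..n. Om n l * F l)"
      by (rule sum.mono_neutral_right) (auto simp: Om_band)
    also have "\<dots> = (\<Sum>i\<le>Nt. Om n (n - Nt + i) * F (n - Nt + i))"
      using n by (intro sum.reindex_bij_witness[of _ "\<lambda>i. n - Nt + i" "\<lambda>l. l - (n - Nt)"]) auto
    finally show ?thesis .
  qed
  have W0: "(\<Sum>i\<le>Nt. Om n (n - Nt + i) * V i j) = 0" if j: "j < Nt" for j
  proof -
    obtain b \<zeta> where bz: "b \<in> {1,2}" "\<zeta> \<in> Z" "\<And>F. node_row M r xs F j = F b \<zeta>"
      using node_row_cases[OF j] by metis
    show ?thesis
      using Om_Wfun_eq_0[OF bz(2,1) n] unfolding shift V_def Wrow_def bz(3) .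
  qed
  have Om1: "Om n n = 1" using lower_Om by (simp add: lower_unitriangular_def)
  show "Bpol Sc n x = 1 / tau Nt Wrow n *
      det_of (Nt + 1) (\<lambda>i j. if j < Nt then Wrow (n - Nt + i) j else Bpol S (n - Nt + i) x)"
  proof -
    have "det_of (Suc Nt) (\<lambda>i j. if j < Nt then V i j else Bpol S (n - Nt + i) x)
        = det_of Nt V * (\<Sum>i\<le>Nt. Om n (n - Nt + i) * Bpol S (n - Nt + i) x)"
      by (rule det_of_bordered) (use n Om1 W0 in auto)
    also have "(\<Sum>i\<le>Nt. Om n (n - Nt + i) * Bpol S (n - Nt + i) x) = (\<Sum>l\<le>n. Om n l * Bpol S l x)"
      by (rule shift[symmetric])
    also have "\<dots> = poly (bpoly Sc n) x"
      unfolding bpoly_Sc by (simp add: poly_sum poly_bpoly[OF lower(1)])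
    also have "\<dots> = Bpol Sc n x" by (simp add: poly_bpoly[OF lower(3)])
    finally show ?thesis using tau unfolding tauV V_def by simp
  qed
  let ?e = "(- 1) ^ (Nt - 1) :: complex"
  have pos: "0 < Nt" using Nt by linarith
  \<comment> \<open>As \<open>Om n n = 1\<close>, the new last row \<open>V Nt\<close> is minus a
    combination of the rows of \<open>V\<close>.\<close>
  have tau_Suc: "tau Nt Wrow (n + 1) = - (?e * Om n (n - Nt) * det_of Nt V)"
  proof -
    have "tau Nt Wrow (n + 1) = det_of Nt (\<lambda>i j. if i < Nt - 1 then V (Suc i) j
        else (\<Sum>l<Nt. - Om n (n - Nt + l) * V l j))"
      unfolding tau_def
    proof (rule det_of_cong)
      fix i j assume ij: "i < Nt" "j < Nt"
      show "Wrow (n + 1 - Nt + i) j = (if i < Nt - 1 then V (Suc i) j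
        else (\<Sum>l<Nt. - Om n (n - Nt + l) * V l j))"
      proof (cases "i < Nt - 1")
        case True
        then show ?thesis using n by (simp add: V_def Suc_diff_le)
      next
        case False
        then have "n + 1 - Nt + i = n" using ij n by auto
        moreover have "V Nt j = - (\<Sum>l<Nt. Om n (n - Nt + l) * V l j)"
          using W0[OF ij(2)] n Om1 by (simp add: lessThan_Suc_atMost[symmetric] eq_neg_iff_add_eq_0 add.commute)
        ultimately show ?thesis using False n by (simp add: V_def sum_negf)
      qed
    qed
    also have "\<dots> = ?e * (- Om n (n - Nt + 0)) * det_of Nt V"
      by (rule det_of_replace_last_row[OF pos])
    finally show ?thesis by simp
  qed
  show "Apol Stc Hc a n y = - (1 / tau Nt Wrow (n + 1)) *
      det_of Nt (\<lambda>i j. if i < Nt - 1 then Wrow (n - Nt + 1 + i) j else kapparow a y j)"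
    if a: "a \<in> {1,2}"
  proof -
    define \<alpha> where "\<alpha> = (\<lambda>i. \<Sum>m = n..<n + Nt. Om m (n - Nt + i) * Apol Stc Hc a m y)"
    have "det_of Nt (\<lambda>i j. if i < Nt - 1 then Wrow (n - Nt + 1 + i) j else kapparow a y j)
        = det_of Nt (\<lambda>i j. if i < Nt - 1 then V (Suc i) j else (\<Sum>l<Nt. \<alpha> l * V l j))"
    proof (rule det_of_cong)
      fix i j assume ij: "i < Nt" "j < Nt"
      obtain b \<zeta> where bz: "b \<in> {1,2}" "\<zeta> \<in> Z" "\<And>F. node_row M r xs F j = F b \<zeta>"
        using node_row_cases[OF ij(2)] by metis
      have "kapparow a y j = (\<Sum>l<Nt. \<alpha> l * V l j)"
        unfolding kapparow_def V_def Wrow_def bz(3) \<alpha>_def by (rule kappa_eq[OF bz(2,1) a n])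
      then show "(if i < Nt - 1 then Wrow (n - Nt + 1 + i) j else kapparow a y j)
          = (if i < Nt - 1 then V (Suc i) j else (\<Sum>l<Nt. \<alpha> l * V l j))"
        by (simp add: V_def)
    qed
    also have "\<dots> = ?e * \<alpha> 0 * det_of Nt V" by (rule det_of_replace_last_row[OF pos])
    \<comment> \<open>Column \<open>n - Nt\<close> of \<open>Om\<close> ends at row
      \<open>n\<close>, so only the term \<open>m = n\<close> is left.\<close>
    also have "\<alpha> 0 = (\<Sum>m\<in>{n}. Om m (n - Nt) * Apol Stc Hc a m y)"
      unfolding \<alpha>_def using n pos by (intro sum.mono_neutral_cong_right) (auto simp: Om_band)
    finally have det: "det_of Nt (\<lambda>i j. if i < Nt - 1 then Wrow (n - Nt + 1 + i) j else kapparow a y j)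
        = - (tau Nt Wrow (n + 1) * Apol Stc Hc a n y)"
      unfolding tau_Suc by simp
    \<comment> \<open>The nonzero band edge carries nonvanishing over from \<open>tau\<close> at
      \<open>n\<close> to \<open>tau\<close> at \<open>n + 1\<close>, which permits the
      division.\<close>
    have "Om n (n - Nt) \<noteq> 0" using Om_band_edge[of "n - Nt"] n by simp
    then have "tau Nt Wrow (n + 1) \<noteq> 0" unfolding tau_Suc using tau by (simp add: tauV)
    then show ?thesis unfolding det by simp
  qed
qed

end

section \<open>The formulas for the given perturbed pair of weights\<close>

theorem theorem13:
  fixes \<Delta> :: "real set" and w :: "nat \<Rightarrow> real \<Rightarrow> real" and wc :: "nat \<Rightarrow> weight"
    and P p Pe Po :: "real poly"
    and N M Nt n :: nat and xs r :: "nat \<Rightarrow> complex" and Z :: "complex set"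
    and c :: "nat \<Rightarrow> complex \<Rightarrow> complex"
    and S St Sc Stc :: imat and H Hc :: ivec
    and Wrow :: "nat \<Rightarrow> nat \<Rightarrow> complex" and kapparow :: "nat \<Rightarrow> complex \<Rightarrow> nat \<Rightarrow> complex"
  assumes "is_interval \<Delta>"
    and moments: "\<And>a k. a \<in> {1,2} \<Longrightarrow> set_integrable lebesgue \<Delta> (\<lambda>t. t ^ k * w a t)"
    and P_roots: "map_poly complex_of_real P = (\<Prod>j<N. [:- xs j, 1:])"
    and p_roots: "map_poly complex_of_real p = (\<Prod>j<M. [:- ((r j)\<^sup>2), 1:])"
    and Nt: "Nt = 2 * M + N" "Nt \<ge> 1"
    and non_symmetric: "\<And>z. z \<noteq> 0 \<Longrightarrow> cpoly P z = 0 \<Longrightarrow> cpoly P (- z) \<noteq> 0"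
    and parts: "P = pcompose Pe [:0, 0, 1:] + [:0, 1:] * pcompose Po [:0, 0, 1:]"
    and distinct_zeros:
      "distinct (map (\<lambda>j. (r j)\<^sup>2) [0..<M] @ map (\<lambda>j. (xs j)\<^sup>2) [0..<N])"
    and Z: "Z = (\<lambda>j. (r j)\<^sup>2) ` {..<M} \<union> (\<lambda>j. (xs j)\<^sup>2) ` {..<N}"
    and cauchy_integrals: "\<And>a \<zeta>. a \<in> {1,2} \<Longrightarrow> \<zeta> \<in> Z \<Longrightarrow>
      set_integrable lebesgue \<Delta> (\<lambda>t. complex_of_real (w a t) / (\<zeta> - complex_of_real t))"
    and wc: "wc = geronimus_weight w Pe Po p Z c"
    and perturbation:
      "weight_eq \<Delta> (weight_plus (weight_times (wc 1) (p * Pe)) (weight_times (wc 2) (p * Po)))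
         (fun_weight (w 1))"
      "weight_eq \<Delta> (weight_plus (weight_times (wc 1) ([:0, 1:] * (p * Po)))
         (weight_times (wc 2) (p * Pe))) (fun_weight (w 2))"
    and LU: "LU_factorization (moment_matrix \<Delta> (\<lambda>a. fun_weight (w a))) S H St"
    and LU_perturbed: "LU_factorization (moment_matrix \<Delta> wc) Sc Hc Stc"
    and Wrow: "\<And>l. Wrow l = node_row M r xs (\<lambda>b z. Wfun \<Delta> w Pe Po p c S b l z)"
    and kapparow: "\<And>a y. kapparow a y =
      node_row M r xs (\<lambda>b z. kappa \<Delta> w wc Pe Po p c S H St Sc Hc Stc n a b z y)"
    and n: "n \<ge> Nt"
    and tau_nonzero: "tau Nt Wrow n \<noteq> 0"
  shows "(\<forall>a\<in>{1,2}. \<forall>y. Apol Stc Hc a n y =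
            - (1 / tau Nt Wrow (n + 1)) *
              det_of Nt (\<lambda>i j. if i < Nt - 1 then Wrow (n - Nt + 1 + i) j else kapparow a y j)) \<and>
         (\<forall>x. Bpol Sc n x =
            1 / tau Nt Wrow n *
              det_of (Nt + 1) (\<lambda>i j. if j < Nt then Wrow (n - Nt + i) j
                                     else Bpol S (n - Nt + i) x))"
proof -
  have mass_wc: "mass (geronimus_weight w Pe Po p Z c b) \<zeta> = c b \<zeta>" if "\<zeta> \<in> Z" for b \<zeta>
    using that by (simp add: geronimus_weight_def)
  \<comment> \<open>Equality of weights includes equality of masses, and those of
    \<open>fun_weight\<close> are zero.\<close>
  have masses: "c 1 \<zeta> * cpoly (p * Pe) \<zeta> + c 2 \<zeta> * cpoly (p * Po) \<zeta> = 0"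
    "c 1 \<zeta> * cpoly ([:0, 1:] * (p * Po)) \<zeta> + c 2 \<zeta> * cpoly (p * Pe) \<zeta> = 0" if "\<zeta> \<in> Z" for \<zeta>
    using perturbation[unfolded weight_eq_def, THEN conjunct2, THEN fun_cong, of \<zeta>]
    unfolding wc weight_plus_def weight_times_def fun_weight_def weight.simps mass_wc[OF that] by auto
  interpret geronimus_LU \<Delta> w P p Pe Po N M xs r Z c S St Sc Stc H Hc
    by unfold_locales (fact moments P_roots p_roots parts distinct_zeros Z cauchy_integrals masses
      LU LU_perturbed[unfolded wc])+
  have W: "Wrow = (\<lambda>l. node_row M r xs (\<lambda>b z. Wfun \<Delta> w Pe Po p c S b l z))"
    and K: "kapparow = (\<lambda>a y. node_row M r xs (\<lambda>b z.
      kappa \<Delta> w (geronimus_weight w Pe Po p Z c) Pe Po p c S H St Sc Hc Stc n a b z y))"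
    by (intro ext, simp add: Wrow kapparow wc)+
  show ?thesis
    using christoffel_formulas[of n] n tau_nonzero \<open>1 \<le> Nt\<close> unfolding W K \<open>Nt = 2 * M + N\<close> by blast
qed

end
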